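(* Let $(p,q)\in\{(2,2),(2,\infty),(\infty,\infty)\}$ and suppose the system $$x(t+1)=Ax(t)+Bw(t),\quad x(0)=0,\qquad y(t)=Cx(t)+Dw(t)+a(t),\qquad t\in\mathbb Z_+,$$ with $\rho$-sparse attack ($\|a\|_0\le\rho$) is $2\rho$-detectable. Then the proposed state estimator (defined in the context) is $\epsilon$-resilient to attack for some finite $\epsilon>0$; that is, with $e=x-\hat x$, there is a finite $\epsilon>0$ such that $\sup_{\|w\|_p\le1,\ \|a\|_0\le\rho}\|e\|_q<\epsilon$.
   Context: System. $x(t)\in\mathbb R^n$ is the state, $w(t)\in\mathbb R^l$ the disturbance, $y(t)\in\mathbb R^m$ the measurement, $a(t)\in\mathbb R^m$ the attack; $A,B,C,D$ are real matrices of compatible sizes and $B$ has full row rank. Sensors are indexed by $\mathcal S=\{1,\dots,m\}$; $\rho$ is a non-negative integer. Norms. $\|x\|_0=|\{i:\exists t,\ x_i(t)\ne0\}|$, $\|x\|_\infty=\sup_t\max_i|x_i(t)|$, $\|x\|_2=(\sum_t\sum_i|x_i(t)|^2)^{1/2}$; $x(0:T)$ is the truncation of $x$ to times $0,\dots,T$, with norms defined by restricting the sup/sum to these times. The block matrix $\left[\begin{array}{c|c}A&B\\\hline C&D\end{array}\right]$ denotes the LTI system $x(t+1)=Ax(t)+Bw(t)$, $y(t)=Cx(t)+Dw(t)$, $x(0)=0$; for such a system $G$, $\|G\|_{p\to q}=\sup_{0<\|w\|_p<\infty}\|y\|_q/\|w\|_p$. Detectability. A square matrix is strictly stable if all its eigenvalues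 lie in the open unit disc; $(A,C)$ is detectable if $A+KC$ is strictly stable for some $K$. For $\mathcal I\subseteq\mathcal S$, $y_{\mathcal I},C_{\mathcal I},D_{\mathcal I}$ denote the restrictions of $y,C,D$ to the rows indexed by $\mathcal I$. For $\chi\in\{0,\dots,m\}$ the system is $\chi$-detectable if $(A,C_{\mathcal K})$ is detectable for every $\mathcal K\subseteq\mathcal S$ with $|\mathcal K|=m-\chi$. The proposed estimator (Algorithm 1). Let $\mathcal V=\{\mathcal I\subseteq\mathcal S:|\mathcal I|=m-\rho\}$. For each $\mathcal I\in\mathcal V$ fix a matrix $K^{\mathcal I}\in\mathbb R^{n\times(m-\rho)}$ with $A+K^{\mathcal I}C_{\mathcal I}$ strictly stable. The local estimator $\mathcal I$ is $$\hat x^{\mathcal I}(t+1)=A\hat x^{\mathcal I}(t)-K^{\mathcal I}\big(y_{\mathcal I}(t)-C_{\mathcal I}\hat x^{\mathcal I}(t)\big),\quad \hat x^{\mathcal I}(0)=0,$$ with residual $r^{\mathcal I}(t)=y_{\mathcal I}(t)-C_{\mathcal I}\hat x^{\mathcal I}(t)$. Put $$F^{\mathcal I}(K^{\mathcal I})=\left[\begin{array}{c|c}A+K^{\mathcal I}C_{\mathcal I}&B+K^{\mathcal I}D_{\mathcal I}\\\hline C_{\mathcal I}&D_{\mathcal I}\end{array}\right].$$ The set of valid local estimators at time $t$ is $\mathcal V(t)=\{\mathcal I\in\mathcal V:\|r^{\mathcal I}(0:t)\|_q\le\|F^{\mathcal I}(K^{\mathcal I})\|_{p\to q}\}$. The global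 estimate $\hat x(t)$ has components $$\hat x_i(t)=\tfrac12\Big(\min_{\mathcal I\in\mathcal V(t)}\hat x_i^{\mathcal I}(t)+\max_{\mathcal J\in\mathcal V(t)}\hat x_i^{\mathcal J}(t)\Big)\ \text{if }q=\infty,\qquad \hat x_i(t)=\frac1{|\mathcal V(t)|}\sum_{\mathcal I\in\mathcal V(t)}\hat x_i^{\mathcal I}(t)\ \text{if }q=2 .$$ *)

theory Defs
  imports
    "Jordan_Normal_Form.Char_Poly"
    "Jordan_Normal_Form.DL_Rank"
    "Jordan_Normal_Form.DL_Submatrix"
    "HOL-Analysis.Infinite_Sum"
begin

text \<open>
  Sensors and coordinates are numbered from \<open>0\<close>, so the sensor set is \<open>{..<m}\<close>.
  Norms of signals take values in \<^typ>\<open>ennreal\<close>: they may be infinite, and suprema over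
  empty index sets are \<open>0\<close>.
\<close>

type_synonym signal = "nat \<Rightarrow> real vec"

definition signals :: "nat \<Rightarrow> signal set" where
  "signals d = {u. \<forall>t. u t \<in> carrier_vec d}"

definition l0_norm :: "signal \<Rightarrow> nat" where
  "l0_norm u = card {i. \<exists>t. i < dim_vec (u t) \<and> u t $ i \<noteq> 0}"

datatype exponent = Two | Infty

definition ennsqrt :: "ennreal \<Rightarrow> ennreal" where
  "ennsqrt s = (if s = \<infinity> then \<infinity> else ennreal (sqrt (enn2real s)))"

text \<open>
  The norm of a signal restricted to a set \<open>T\<close> of times: \<open>UNIV\<close> gives the norm of the whole
  signal, \<open>{..t}\<close> the norm of its truncation to the times \<open>0, \<dots>, t\<close>.
\<close>

fun signal_norm :: "exponent \<Rightarrow> nat set \<Rightarrow> signal \<Rightarrow> ennreal" where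
  "signal_norm Infty T u = (SUP t\<in>T. SUP i\<in>{..<dim_vec (u t)}. ennreal \<bar>u t $ i\<bar>)"
| "signal_norm Two T u =
     ennsqrt (\<Sum>\<^sub>\<infinity>t\<in>T. \<Sum>i<dim_vec (u t). ennreal (\<bar>u t $ i\<bar>\<^sup>2))"

text \<open>The tuple \<open>(A, B, C, D)\<close> stands for the system with zero initial state.\<close>

type_synonym lti = "real mat \<times> real mat \<times> real mat \<times> real mat"

fun lti_state :: "lti \<Rightarrow> signal \<Rightarrow> signal" where
  "lti_state (A, B, C, D) w 0 = 0\<^sub>v (dim_row A)"
| "lti_state (A, B, C, D) w (Suc t) = A *\<^sub>v lti_state (A, B, C, D) w t + B *\<^sub>v w t"

fun lti_output :: "lti \<Rightarrow> signal \<Rightarrow> signal" where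
  "lti_output (A, B, C, D) w t = C *\<^sub>v lti_state (A, B, C, D) w t + D *\<^sub>v w t"

fun state_dim :: "lti \<Rightarrow> nat" where
  "state_dim (A, B, C, D) = dim_row A"

fun input_dim :: "lti \<Rightarrow> nat" where
  "input_dim (A, B, C, D) = dim_col B"

fun output_dim :: "lti \<Rightarrow> nat" where
  "output_dim (A, B, C, D) = dim_row C"

definition induced_norm :: "exponent \<Rightarrow> exponent \<Rightarrow> lti \<Rightarrow> ennreal" where
  "induced_norm p q G =
     (SUP w\<in>{w \<in> signals (input_dim G). 0 < signal_norm p UNIV w \<and> signal_norm p UNIV w < \<infinity>}.
        signal_norm q UNIV (lti_output G w) / signal_norm p UNIV w)"

definition strictly_stable :: "real mat \<Rightarrow> bool" where
  "strictly_stable M \<longleftrightarrow>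
     square_mat M \<and> (\<forall>z. eigenvalue (map_mat complex_of_real M) z \<longrightarrow> cmod z < 1)"

definition detectable :: "real mat \<Rightarrow> real mat \<Rightarrow> bool" where
  "detectable A C \<longleftrightarrow>
     (\<exists>K \<in> carrier_mat (dim_row A) (dim_row C). strictly_stable (A + K * C))"

text \<open>Selected rows are kept in increasing order of their index.\<close>

definition mat_rows :: "real mat \<Rightarrow> nat set \<Rightarrow> real mat" where
  "mat_rows M I = submatrix M I UNIV"

definition vec_rows :: "real vec \<Rightarrow> nat set \<Rightarrow> real vec" where
  "vec_rows v I = vec (card {i. i < dim_vec v \<and> i \<in> I}) (\<lambda>i. v $ pick I i)"

fun chi_detectable :: "nat \<Rightarrow> lti \<Rightarrow> bool" where
  "chi_detectable \<chi> (A, B, C, D) \<longleftrightarrow>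
     \<chi> \<le> dim_row C \<and>
     (\<forall>\<K>. \<K> \<subseteq> {..<dim_row C} \<and> card \<K> = dim_row C - \<chi> \<longrightarrow> detectable A (mat_rows C \<K>))"

definition sensor_sets :: "nat \<Rightarrow> nat \<Rightarrow> nat set set" where
  "sensor_sets m \<rho> = {I. I \<subseteq> {..<m} \<and> card I = m - \<rho>}"

text \<open>Below, \<open>L\<close> is the gain of a single local estimator and \<open>K\<close> the family of all gains.\<close>

fun local_estimate :: "lti \<Rightarrow> nat set \<Rightarrow> real mat \<Rightarrow> signal \<Rightarrow> signal" where
  "local_estimate (A, B, C, D) I L y 0 = 0\<^sub>v (dim_row A)"
| "local_estimate (A, B, C, D) I L y (Suc t) =
     A *\<^sub>v local_estimate (A, B, C, D) I L y t
     - L *\<^sub>v (vec_rows (y t) I - mat_rows C I *\<^sub>v local_estimate (A, B, C, D) I L y t)"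

fun local_residual :: "lti \<Rightarrow> nat set \<Rightarrow> real mat \<Rightarrow> signal \<Rightarrow> signal" where
  "local_residual (A, B, C, D) I L y t =
     vec_rows (y t) I - mat_rows C I *\<^sub>v local_estimate (A, B, C, D) I L y t"

fun residual_system :: "lti \<Rightarrow> nat set \<Rightarrow> real mat \<Rightarrow> lti" where
  "residual_system (A, B, C, D) I L =
     (A + L * mat_rows C I, B + L * mat_rows D I, mat_rows C I, mat_rows D I)"

definition valid_sets ::
    "exponent \<Rightarrow> exponent \<Rightarrow> lti \<Rightarrow> nat \<Rightarrow> (nat set \<Rightarrow> real mat) \<Rightarrow> signal \<Rightarrow> nat \<Rightarrow> nat set set" where
  "valid_sets p q G \<rho> K y t =
     {I \<in> sensor_sets (output_dim G) \<rho>.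
        signal_norm q {..t} (local_residual G I (K I) y)
        \<le> induced_norm p q (residual_system G I (K I))}"

definition global_estimate ::
    "exponent \<Rightarrow> exponent \<Rightarrow> lti \<Rightarrow> nat \<Rightarrow> (nat set \<Rightarrow> real mat) \<Rightarrow> signal \<Rightarrow> signal" where
  "global_estimate p q G \<rho> K y t =
     vec (state_dim G) (\<lambda>i.
       let V = valid_sets p q G \<rho> K y t;
           est = (\<lambda>I. local_estimate G I (K I) y t $ i)
       in case q of
            Infty \<Rightarrow> (Min (est ` V) + Max (est ` V)) / 2
          | Two \<Rightarrow> (\<Sum>I\<in>V. est I) / real (card V))"

text \<open>The estimator is a map from measurement signals to state estimates; \<open>w\<close> ranges over disturbances
  and \<open>a\<close> over attacks added to the measurement.\<close>

definition resilient ::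
    "exponent \<Rightarrow> exponent \<Rightarrow> lti \<Rightarrow> nat \<Rightarrow> (signal \<Rightarrow> signal) \<Rightarrow> real \<Rightarrow> bool" where
  "resilient p q G \<rho> estimator \<epsilon> \<longleftrightarrow>
     (SUP (w, a)\<in>{(w, a). w \<in> signals (input_dim G) \<and> a \<in> signals (output_dim G)
                     \<and> signal_norm p UNIV w \<le> 1 \<and> l0_norm a \<le> \<rho>}.
        signal_norm q UNIV
          (\<lambda>t. lti_state G w t - estimator (\<lambda>s. lti_output G w s + a s) t)) < ennreal \<epsilon>"

end

theory Submission
  imports
    Defs
    "Jordan_Normal_Form.Spectral_Radius"
    "HOL-Analysis.L2_Norm"
begin

text \<open>
  A \<open>\<rho>\<close>-sparse attack leaves some set \<open>J\<close> of \<open>m - \<rho>\<close> sensors untouched. For this set the error of the local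
  estimator and its residual are the state and output of the stable system \<open>F\<^sup>J\<close> driven by the disturbance
  alone (\<open>attack_free_local_estimate\<close>). So the local estimate is within a finite distance of the true state,
  and since the disturbance has norm at most \<open>1\<close> the residual never exceeds the induced norm of \<open>F\<^sup>J\<close>:
  \<open>J\<close> is valid at all times.

  An attacked set \<open>I\<close> may also be valid, but then its residual up to the current time is bounded by the
  induced norm of \<open>F\<^sup>I\<close>, which is finite by strict stability. Now \<open>I \<inter> J\<close> contains at least \<open>m - 2\<rho>\<close> sensors, from
  which the system is detectable. Seen through these sensors, the difference of the two local estimates
  is the difference of their residuals, so an output injection turns that difference into the state of
  a strictly stable system driven by residuals only (\<open>local_estimates_agree\<close>). Every valid local estimate
  therefore stays close to that of \<open>J\<close>, and so does the global estimate, which lies coordinatewise in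
  the convex hull of the valid ones.

  For \<open>q = 2\<close> closeness at each time is not enough, because the errors have to be square summable although
  the set of valid estimators changes. The contribution of each \<open>I\<close> is square summable over the times
  at which \<open>I\<close> is valid, and there are finitely many \<open>I\<close> (\<open>global_estimate_near_always_valid\<close>).

  The only analytic input is that strictly stable recursions have finite gain
  (\<open>stable_recursion_bound\<close>). Since an \<open>\<ell>\<^sup>2\<close> bound is also an \<open>\<ell>\<^sup>\<infinity>\<close> bound, it suffices to have this from
  each norm to itself, and a single predicate covering both norms lets all arguments be given once.
\<close>

section \<open>Norm bounds on real sequences\<close>

text \<open>
  The estimates are made on real sequences such as \<open>t \<mapsto> \<parallel>u t\<parallel>\<^sub>1\<close> with real bounds; arithmetic in
  \<^typ>\<open>ennreal\<close> is confined to the conversion from and to signal norms and to induced norms. The case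
  \<open>Two\<close> quantifies over finite subsets of \<open>T\<close>, which expresses an \<open>\<ell>\<^sup>2\<close> bound on an infinite set of times
  without any summability side condition.
\<close>

fun norm_bounded :: "exponent \<Rightarrow> nat set \<Rightarrow> (nat \<Rightarrow> real) \<Rightarrow> real \<Rightarrow> bool" where
  "norm_bounded Infty T v b \<longleftrightarrow> (\<forall>t\<in>T. \<bar>v t\<bar> \<le> b)"
| "norm_bounded Two T v b \<longleftrightarrow> (\<forall>F. finite F \<longrightarrow> F \<subseteq> T \<longrightarrow> L2_set v F \<le> b)"

lemma norm_bounded_mono:
  assumes "norm_bounded q T v b" "T' \<subseteq> T" "\<And>t. t \<in> T' \<Longrightarrow> \<bar>v' t\<bar> \<le> \<bar>v t\<bar>" "b \<le> b'"
  shows "norm_bounded q T' v' b'"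
proof (cases q)
  case Two
  have "L2_set v' F \<le> b'" if F: "finite F" "F \<subseteq> T'" for F
  proof -
    have "L2_set v' F \<le> L2_set v F"
      unfolding L2_set_def using F assms(3)
      by (intro real_sqrt_le_mono sum_mono) (metis abs_le_square_iff subsetD)
    also have "\<dots> \<le> b" using assms(1,2) F Two by auto
    finally show ?thesis using assms(4) by simp
  qed
  then show ?thesis using Two by simp
next
  case Infty
  have "\<bar>v' t\<bar> \<le> b'" if "t \<in> T'" for t
    using assms(1,2,4) assms(3)[OF that] that Infty by (meson norm_bounded.simps(1) order_trans subsetD)
  then show ?thesis using Infty by simp
qed

lemma norm_bounded_add:
  assumes "norm_bounded q T v b" "norm_bounded q T v' b'"
  shows "norm_bounded q T (\<lambda>t. v t + v' t) (b + b')"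
proof (cases q)
  case Two
  then show ?thesis using assms by (auto intro!: order_trans[OF L2_set_triangle_ineq] add_mono)
next
  case Infty
  then show ?thesis using assms by (auto intro!: order_trans[OF abs_triangle_ineq] add_mono)
qed

lemma norm_bounded_scale:
  assumes "norm_bounded q T v b" "0 \<le> c"
  shows "norm_bounded q T (\<lambda>t. c * v t) (c * b)"
  using assms by (cases q) (auto simp: L2_set_right_distrib[symmetric] abs_mult intro!: mult_left_mono)

lemma norm_bounded_sum:
  assumes "finite J" "\<And>j. j \<in> J \<Longrightarrow> norm_bounded q T (v j) (b j)"
  shows "norm_bounded q T (\<lambda>t. \<Sum>j\<in>J. v j t) (\<Sum>j\<in>J. b j)"
  using assms
proof (induction J rule: finite_induct)
  case empty
  show ?case by (cases q) (auto simp: L2_set_def)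
next
  case (insert j J)
  then show ?case by (simp add: norm_bounded_add)
qed

text \<open>
  A finite \<open>F \<subseteq> S\<close> is contained in \<open>{..Max F}\<close>, and \<open>Max F \<in> S\<close>. Besides \<open>S = UNIV\<close>, the relevant \<open>S\<close> is
  the set of times at which a local estimator is valid: validity at \<open>t\<close> only controls the signals up
  to \<open>t\<close>, yet the bound obtained on the whole set of valid times is the same one.
\<close>

lemma norm_bounded_from_truncations:
  assumes "\<And>t. t \<in> S \<Longrightarrow> norm_bounded q {..t} v b" "0 \<le> b"
  shows "norm_bounded q S v b"
proof (cases q)
  case Two
  have "L2_set v F \<le> b" if F: "finite F" "F \<subseteq> S" for F
  proof (cases "F = {}")
    case False
    then have "Max F \<in> S" "F \<subseteq> {..Max F}" using F Max_in[of F] by (blast, auto)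
    then show ?thesis using assms(1)[of "Max F"] F Two by auto
  qed (use assms in auto)
  then show ?thesis using Two by simp
next
  case Infty
  then show ?thesis using assms by auto
qed

lemma norm_bounded_extend_by_zero:
  assumes "norm_bounded q S v b" "0 \<le> b"
  shows "norm_bounded q UNIV (\<lambda>t. if t \<in> S then v t else 0) b"
proof (cases q)
  case Two
  have "L2_set (\<lambda>t. if t \<in> S then v t else 0) F \<le> b" if F: "finite F" for F
  proof -
    have "L2_set (\<lambda>t. if t \<in> S then v t else 0) F = L2_set v (F \<inter> S)"
      unfolding L2_set_def using F
      by (auto simp: sum.inter_restrict intro!: arg_cong[where f=sqrt] sum.cong)
    then show ?thesis using assms F Two by auto
  qed
  then show ?thesis using Two by simp
next
  case Infty
  then show ?thesis using assms by auto
qed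

text \<open>
  This embedding reduces the mixed case \<open>(p, q) = (Two, Infty)\<close> to \<open>(Infty, Infty)\<close>.
\<close>

lemma norm_bounded_Two_imp_Infty:
  assumes "norm_bounded Two T v b"
  shows "norm_bounded Infty T v b"
proof -
  have "\<bar>v t\<bar> \<le> b" if "t \<in> T" for t
    using assms[unfolded norm_bounded.simps, rule_format, of "{t}"] that by (simp add: L2_set_def)
  then show ?thesis by simp
qed

text \<open>
  A scalar stable filter has finite gain in both norms. For \<open>Infty\<close> the bound is a fixed point of the
  recursion. For \<open>Two\<close>, convexity of the square applied to
  \<open>\<gamma> g + v = \<gamma> g + (1 - \<gamma>) (v / (1 - \<gamma>))\<close> gives \<open>g(t + 1)\<^sup>2 \<le> \<gamma> g(t)\<^sup>2 + v(t)\<^sup>2 / (1 - \<gamma>)\<close>, and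
  summing this dissipation inequality bounds the energy of \<open>g\<close> by that of \<open>v\<close>.
\<close>

lemma geometric_filter_bound:
  fixes g v :: "nat \<Rightarrow> real"
  assumes \<gamma>: "0 \<le> \<gamma>" "\<gamma> < 1" and v: "\<And>t. 0 \<le> v t"
    and g: "g 0 = 0" "\<And>t. g (Suc t) = \<gamma> * g t + v t"
    and b: "0 \<le> b" "norm_bounded q {..T} v b"
  shows "norm_bounded q {..T} g (b / (1 - \<gamma>))"
proof -
  have g_nonneg: "0 \<le> g t" for t by (induction t) (use g \<gamma> v in auto)
  show ?thesis
  proof (cases q)
    case Infty
    have "g t \<le> b / (1 - \<gamma>)" if "t \<le> T" for t
      using that
    proof (induction t)
      case 0
      then show ?case using g b \<gamma> by simp
    next
      case (Suc t)
      then have "g (Suc t) \<le> \<gamma> * (b / (1 - \<gamma>)) + b"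
        using g(2)[of t] b \<gamma> Infty
        by (auto intro!: add_mono mult_left_mono simp del: times_divide_eq_right dest!: bspec[of _ _ t])
      also have "\<dots> = b / (1 - \<gamma>)" using \<gamma> by (simp add: field_simps)
      finally show ?case .
    qed
    then show ?thesis using Infty g_nonneg by simp
  next
    case Two
    have step: "(g (Suc t))\<^sup>2 \<le> \<gamma> * (g t)\<^sup>2 + (v t)\<^sup>2 / (1 - \<gamma>)" for t
    proof -
      \<comment> \<open>The gap in the convexity inequality is \<open>\<gamma> (1 - \<gamma>) (g t - u)\<^sup>2\<close>.\<close>
      define u where "u = v t / (1 - \<gamma>)"
      have vu: "v t = (1 - \<gamma>) * u" "(v t)\<^sup>2 / (1 - \<gamma>) = (1 - \<gamma>) * u\<^sup>2"
        using \<gamma> by (auto simp: u_def power2_eq_square)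
      have "\<gamma> * (g t)\<^sup>2 + (1 - \<gamma>) * u\<^sup>2 - (\<gamma> * g t + (1 - \<gamma>) * u)\<^sup>2 = \<gamma> * (1 - \<gamma>) * (g t - u)\<^sup>2"
        by (simp add: power2_eq_square algebra_simps)
      moreover have "0 \<le> \<gamma> * (1 - \<gamma>) * (g t - u)\<^sup>2" using \<gamma> by simp
      ultimately show ?thesis unfolding g(2) vu(2) unfolding vu(1) by linarith
    qed
    have energy: "(g t)\<^sup>2 + (1 - \<gamma>) * (\<Sum>s<t. (g s)\<^sup>2) \<le> (\<Sum>s<t. (v s)\<^sup>2) / (1 - \<gamma>)" for t
    proof (induction t)
      case 0
      then show ?case using g by simp
    next
      case (Suc t)
      have "(1 - \<gamma>) * (\<Sum>s<Suc t. (g s)\<^sup>2) = (1 - \<gamma>) * (\<Sum>s<t. (g s)\<^sup>2) + (g t)\<^sup>2 - \<gamma> * (g t)\<^sup>2"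
        by (simp add: algebra_simps)
      moreover have "(\<Sum>s<Suc t. (v s)\<^sup>2) / (1 - \<gamma>) = (\<Sum>s<t. (v s)\<^sup>2) / (1 - \<gamma>) + (v t)\<^sup>2 / (1 - \<gamma>)"
        by (simp add: add_divide_distrib)
      ultimately show ?case using step[of t] Suc.IH by linarith
    qed
    have "L2_set g F \<le> b / (1 - \<gamma>)" if F: "finite F" "F \<subseteq> {..T}" for F
    proof -
      have "(\<Sum>t\<in>F. (g t)\<^sup>2) \<le> (\<Sum>t<Suc T. (g t)\<^sup>2)"
        using F by (intro sum_mono2) auto
      also have "\<dots> \<le> (\<Sum>t<Suc T. (v t)\<^sup>2) / (1 - \<gamma>) / (1 - \<gamma>)"
      proof -
        have "(1 - \<gamma>) * (\<Sum>t<Suc T. (g t)\<^sup>2) \<le> (\<Sum>t<Suc T. (v t)\<^sup>2) / (1 - \<gamma>)"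
          using energy[of "Suc T"] zero_le_power2[of "g (Suc T)"] by linarith
        then show ?thesis using \<gamma> by (simp add: pos_le_divide_eq mult.commute)
      qed
      also have "\<dots> \<le> b\<^sup>2 / (1 - \<gamma>) / (1 - \<gamma>)"
      proof -
        have "L2_set v {..T} \<le> b" using b Two by simp
        then have "(L2_set v {..T})\<^sup>2 \<le> b\<^sup>2" by (intro power_mono) auto
        then have "(\<Sum>t<Suc T. (v t)\<^sup>2) \<le> b\<^sup>2"
          by (simp add: L2_set_def sum_nonneg lessThan_Suc_atMost)
        then show ?thesis using \<gamma> by (intro divide_right_mono) auto
      qed
      also have "\<dots> = (b / (1 - \<gamma>))\<^sup>2" by (simp add: power2_eq_square)
      finally show ?thesis
        unfolding L2_set_def using b \<gamma> by (intro real_le_lsqrt) (auto intro: sum_nonneg)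
    qed
    then show ?thesis using Two by simp
  qed
qed

section \<open>The 1-norm of vectors\<close>

definition l1_norm :: "real vec \<Rightarrow> real" where
  "l1_norm v = (\<Sum>i<dim_vec v. \<bar>v $ i\<bar>)"

lemma l1_norm_nonneg [simp]: "0 \<le> l1_norm v" "\<bar>l1_norm v\<bar> = l1_norm v"
  by (auto simp: l1_norm_def sum_nonneg)

lemma l1_norm_zero [simp]: "l1_norm (0\<^sub>v n) = 0"
  by (simp add: l1_norm_def)

lemma l1_norm_add:
  assumes "u \<in> carrier_vec n" "v \<in> carrier_vec n"
  shows "l1_norm (u + v) \<le> l1_norm u + l1_norm v"
proof -
  have "l1_norm (u + v) = (\<Sum>i<n. \<bar>u $ i + v $ i\<bar>)"
    using assms by (auto simp: l1_norm_def)
  also have "\<dots> \<le> (\<Sum>i<n. \<bar>u $ i\<bar> + \<bar>v $ i\<bar>)"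
    by (intro sum_mono) linarith
  finally have "l1_norm (u + v) \<le> (\<Sum>i<n. \<bar>u $ i\<bar> + \<bar>v $ i\<bar>)" .
  then show ?thesis using assms by (simp add: l1_norm_def sum.distrib)
qed

lemma l1_norm_diff:
  assumes "u \<in> carrier_vec n" "v \<in> carrier_vec n"
  shows "l1_norm (u - v) \<le> l1_norm u + l1_norm v"
proof -
  have "l1_norm (u - v) = (\<Sum>i<n. \<bar>u $ i - v $ i\<bar>)"
    using assms by (auto simp: l1_norm_def)
  also have "\<dots> \<le> (\<Sum>i<n. \<bar>u $ i\<bar> + \<bar>v $ i\<bar>)"
    by (intro sum_mono) linarith
  finally have "l1_norm (u - v) \<le> (\<Sum>i<n. \<bar>u $ i\<bar> + \<bar>v $ i\<bar>)" .
  then show ?thesis using assms by (simp add: l1_norm_def sum.distrib)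
qed

lemma abs_index_le_l1_norm: "i < dim_vec v \<Longrightarrow> \<bar>v $ i\<bar> \<le> l1_norm v"
  unfolding l1_norm_def by (rule member_le_sum) auto

lemma l1_norm_mult_mat_vec:
  assumes "M \<in> carrier_mat r d" "x \<in> carrier_vec d"
    and "\<And>i j. i < r \<Longrightarrow> j < d \<Longrightarrow> \<bar>M $$ (i, j)\<bar> \<le> c"
  shows "l1_norm (M *\<^sub>v x) \<le> real r * c * l1_norm x"
proof -
  have "\<bar>(M *\<^sub>v x) $ i\<bar> \<le> c * l1_norm x" if i: "i < r" for i
  proof -
    have "(M *\<^sub>v x) $ i = (\<Sum>j<d. M $$ (i, j) * x $ j)"
      using assms(1,2) i by (auto simp: scalar_prod_def atLeast0LessThan intro!: sum.cong)
    then have "\<bar>(M *\<^sub>v x) $ i\<bar> \<le> (\<Sum>j<d. \<bar>M $$ (i, j) * x $ j\<bar>)"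
      by simp
    also have "\<dots> \<le> (\<Sum>j<d. c * \<bar>x $ j\<bar>)"
      using assms(3) i by (intro sum_mono) (simp add: abs_mult mult_right_mono)
    also have "\<dots> = c * l1_norm x"
      using assms(2) by (simp add: l1_norm_def sum_distrib_left)
    finally show ?thesis .
  qed
  then have "(\<Sum>i<r. \<bar>(M *\<^sub>v x) $ i\<bar>) \<le> (\<Sum>i<r. c * l1_norm x)"
    by (intro sum_mono) simp
  then have "l1_norm (M *\<^sub>v x) \<le> (\<Sum>i<r. c * l1_norm x)"
    using assms(1) by (simp only: l1_norm_def[of "M *\<^sub>v x"] dim_mult_mat_vec carrier_matD)
  then show ?thesis by simp
qed

lemma mult_mat_vec_l1_bounded:
  assumes "M \<in> carrier_mat r d"
  shows "\<exists>c\<ge>0. \<forall>x\<in>carrier_vec d. l1_norm (M *\<^sub>v x) \<le> c * l1_norm x"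
proof -
  define c where "c = (\<Sum>i<r. \<Sum>j<d. \<bar>M $$ (i, j)\<bar>)"
  have "\<bar>M $$ (i, j)\<bar> \<le> c" if "i < r" "j < d" for i j
  proof -
    have "\<bar>M $$ (i, j)\<bar> \<le> (\<Sum>j<d. \<bar>M $$ (i, j)\<bar>)" using that by (intro member_le_sum) auto
    also have "\<dots> \<le> c" unfolding c_def using that
      by (intro member_le_sum[where f="\<lambda>i. \<Sum>j<d. \<bar>M $$ (i, j)\<bar>"]) (auto intro: sum_nonneg)
    finally show ?thesis .
  qed
  moreover have "0 \<le> c" unfolding c_def by (intro sum_nonneg) auto
  ultimately show ?thesis
    using l1_norm_mult_mat_vec[OF assms, of _ c] by (intro exI[of _ "real r * c"]) auto
qed

lemma smult_pow_mat:
  fixes P :: "'a :: comm_ring_1 mat"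
  assumes "P \<in> carrier_mat n n"
  shows "(a \<cdot>\<^sub>m P) ^\<^sub>m k = a ^ k \<cdot>\<^sub>m (P ^\<^sub>m k)"
proof (induction k)
  case 0
  then show ?case using assms by auto
next
  case (Suc k)
  have "(a ^ k \<cdot>\<^sub>m (P ^\<^sub>m k)) * (a \<cdot>\<^sub>m P) = (a ^ k * a) \<cdot>\<^sub>m (P ^\<^sub>m k * P)"
    using assms mult_smult_assoc_mat[of "P ^\<^sub>m k" n n "a \<cdot>\<^sub>m P" n "a ^ k"] mult_smult_distrib[of "P ^\<^sub>m k" n n P n a]
    by (intro eq_matI) auto
  then show ?case using Suc by (simp add: mult.commute)
qed

section \<open>Stable recursions\<close>

text \<open>
  Strict stability leaves room for a rate \<open>\<gamma>\<close> strictly between the spectral radius and \<open>1\<close>. The matrix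
  \<open>M / \<gamma>\<close> still has spectral radius below \<open>1\<close>, so by its Jordan normal form its powers are bounded;
  scaling back turns that bound into geometric decay of the powers of \<open>M\<close>.
\<close>

lemma strictly_stable_power_decay:
  assumes M: "M \<in> carrier_mat n n" and st: "strictly_stable M"
  shows "\<exists>c \<gamma>. 0 \<le> c \<and> 0 \<le> \<gamma> \<and> \<gamma> < 1 \<and>
    (\<forall>k. \<forall>x\<in>carrier_vec n. l1_norm (M ^\<^sub>m k *\<^sub>v x) \<le> c * \<gamma> ^ k * l1_norm x)"
proof (cases "n = 0")
  case True
  then show ?thesis using M
    by (intro exI[of _ 0]) (auto simp: l1_norm_def)
next
  case False
  then have n: "n > 0" by simp
  define P where "P = map_mat complex_of_real M"
  have P: "P \<in> carrier_mat n n" using M by (simp add: P_def)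
  define s where "s = spectral_radius P"
  have s: "0 \<le> s" "s < 1" and s_max: "\<And>z. eigenvalue P z \<Longrightarrow> cmod z \<le> s"
    using spectral_radius_mem_max[OF P n] st
    by (auto simp: s_def P_def strictly_stable_def spectrum_def)
  define \<gamma> where "\<gamma> = (1 + s) / 2"
  have \<gamma>: "0 < \<gamma>" "\<gamma> < 1" "s < \<gamma>" using s by (auto simp: \<gamma>_def)
  define Q where "Q = complex_of_real (1 / \<gamma>) \<cdot>\<^sub>m P"
  have Q: "Q \<in> carrier_mat n n" using P by (simp add: Q_def)
  have "cmod z < 1" if z: "eigenvalue Q z" for z
  proof -
    from z obtain v where v: "v \<in> carrier_vec n" "v \<noteq> 0\<^sub>v n" "Q *\<^sub>v v = z \<cdot>\<^sub>v v"
      using Q by (auto simp: eigenvalue_def eigenvector_def)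
    have "Q *\<^sub>v v = complex_of_real (1 / \<gamma>) \<cdot>\<^sub>v (P *\<^sub>v v)"
      using v(1) P unfolding Q_def by (intro eq_vecI) auto
    then have "complex_of_real \<gamma> \<cdot>\<^sub>v (complex_of_real (1 / \<gamma>) \<cdot>\<^sub>v (P *\<^sub>v v)) = complex_of_real \<gamma> \<cdot>\<^sub>v (z \<cdot>\<^sub>v v)"
      using v by simp
    then have "P *\<^sub>v v = (complex_of_real \<gamma> * z) \<cdot>\<^sub>v v"
      using \<gamma> by (simp add: smult_smult_assoc)
    then have "eigenvalue P (complex_of_real \<gamma> * z)"
      using v P by (auto simp: eigenvalue_def eigenvector_def)
    from s_max[OF this] have "\<gamma> * cmod z \<le> s" using \<gamma> by (simp add: norm_mult)
    then have "\<gamma> * cmod z < \<gamma> * 1" using \<gamma>(3) by linarith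
    then show ?thesis using \<gamma>(1) by (simp only: mult_less_cancel_left_pos)
  qed
  then have "spectral_radius Q < 1"
    using spectral_radius_mem_max(1)[OF Q n] by (auto simp: spectrum_def)
  from spectral_radius_jnf_norm_bound_less_1_upper_triangular[OF Q this]
  obtain c where c: "\<And>k. norm_bound (Q ^\<^sub>m k) c" by auto
  have entry: "\<bar>(M ^\<^sub>m k) $$ (i, j)\<bar> \<le> c * \<gamma> ^ k" if ij: "i < n" "j < n" for i j k
  proof -
    have "Q ^\<^sub>m k = complex_of_real (1 / \<gamma>) ^ k \<cdot>\<^sub>m map_mat complex_of_real (M ^\<^sub>m k)"
      unfolding Q_def smult_pow_mat[OF P] by (simp add: P_def of_real_hom.mat_hom_pow[OF M])
    then have "cmod ((Q ^\<^sub>m k) $$ (i, j)) = (1 / \<gamma>) ^ k * \<bar>(M ^\<^sub>m k) $$ (i, j)\<bar>"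
      using ij M \<gamma> by (simp add: norm_mult norm_power norm_divide power_one_over)
    moreover have "cmod ((Q ^\<^sub>m k) $$ (i, j)) \<le> c"
      using c[of k] ij Q by (simp add: norm_bound_def)
    ultimately have "(1 / \<gamma>) ^ k * \<bar>(M ^\<^sub>m k) $$ (i, j)\<bar> \<le> c" by simp
    then have "\<gamma> ^ k * ((1 / \<gamma>) ^ k * \<bar>(M ^\<^sub>m k) $$ (i, j)\<bar>) \<le> \<gamma> ^ k * c"
      using \<gamma> by (intro mult_left_mono) auto
    then show ?thesis using \<gamma> by (simp add: power_one_over mult.commute)
  qed
  have "0 \<le> c" using order_trans[OF abs_ge_zero entry[of 0 0 0]] n by simp
  moreover have "l1_norm (M ^\<^sub>m k *\<^sub>v x) \<le> real n * c * \<gamma> ^ k * l1_norm x" if "x \<in> carrier_vec n" for x k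
    using l1_norm_mult_mat_vec[OF pow_carrier_mat[OF M] that entry] by (simp add: mult.assoc)
  ultimately show ?thesis using \<gamma>
    by (intro exI[of _ "real n * c"] exI[of _ \<gamma>]) auto
qed

text \<open>
  The state is dominated by a scalar geometric filter driven by the size of the input. One constant
  serves both norms, all inputs and all horizons \<open>T\<close>.
\<close>

lemma stable_recursion_bound:
  assumes M: "M \<in> carrier_mat n n" and st: "strictly_stable M"
  shows "\<exists>c\<ge>0. \<forall>q x u T b.
    x 0 = 0\<^sub>v n \<longrightarrow> (\<forall>t. u t \<in> carrier_vec n) \<longrightarrow> (\<forall>t. x (Suc t) = M *\<^sub>v x t + u t) \<longrightarrow>
    0 \<le> b \<longrightarrow> norm_bounded q {..T} (\<lambda>t. l1_norm (u t)) b \<longrightarrow>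
    norm_bounded q {..T} (\<lambda>t. l1_norm (x t)) (c * b)"
proof -
  obtain c \<gamma> where c: "0 \<le> c" and \<gamma>: "0 \<le> \<gamma>" "\<gamma> < 1"
    and decay: "\<And>k x. x \<in> carrier_vec n \<Longrightarrow> l1_norm (M ^\<^sub>m k *\<^sub>v x) \<le> c * \<gamma> ^ k * l1_norm x"
    using strictly_stable_power_decay[OF assms] by auto
  have bound: "norm_bounded q {..T} (\<lambda>t. l1_norm (x t)) (c / (1 - \<gamma>) * b)"
    if x0: "x 0 = 0\<^sub>v n" and u: "\<And>t. u t \<in> carrier_vec n" and xS: "\<And>t. x (Suc t) = M *\<^sub>v x t + u t"
      and b: "0 \<le> b" "norm_bounded q {..T} (\<lambda>t. l1_norm (u t)) b" for q x u T b
  proof -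
    define g where "g = rec_nat 0 (\<lambda>t a. \<gamma> * a + l1_norm (u t))"
    have g: "g 0 = 0" "\<And>t. g (Suc t) = \<gamma> * g t + l1_norm (u t)" by (auto simp: g_def)
    have x: "x t \<in> carrier_vec n" for t by (induction t) (use x0 xS u M in auto)
    \<comment> \<open>Bounding all \<open>M ^\<^sub>m k *\<^sub>v x t\<close> simultaneously replaces the variation-of-constants formula: the
      induction step shifts \<open>k\<close> by one, so the constant \<open>c\<close> is paid only once.\<close>
    have "l1_norm (M ^\<^sub>m k *\<^sub>v x t) \<le> c * \<gamma> ^ k * g t" for k t
    proof (induction t arbitrary: k)
      case 0
      then show ?case using decay[of "x 0" k] x0 g by simp
    next
      case (Suc t)
      have Mk: "M ^\<^sub>m k \<in> carrier_mat n n" using M by simp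
      have "M ^\<^sub>m k *\<^sub>v x (Suc t) = M ^\<^sub>m Suc k *\<^sub>v x t + M ^\<^sub>m k *\<^sub>v u t"
        using mult_add_distrib_mat_vec[OF Mk, of "M *\<^sub>v x t" "u t"] assoc_mult_mat_vec[OF Mk M x[of t]] M u[of t] x[of t]
        by (simp add: xS)
      then have "l1_norm (M ^\<^sub>m k *\<^sub>v x (Suc t)) \<le> l1_norm (M ^\<^sub>m Suc k *\<^sub>v x t) + l1_norm (M ^\<^sub>m k *\<^sub>v u t)"
        using l1_norm_add[of "M ^\<^sub>m Suc k *\<^sub>v x t" n "M ^\<^sub>m k *\<^sub>v u t"] mult_mat_vec_carrier[OF pow_carrier_mat[OF M]] x[of t] u[of t] by metis
      also have "\<dots> \<le> c * \<gamma> ^ Suc k * g t + c * \<gamma> ^ k * l1_norm (u t)"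
        using Suc[of "Suc k"] decay[OF u] by (intro add_mono)
      also have "\<dots> = c * \<gamma> ^ k * g (Suc t)" by (simp add: g algebra_simps)
      finally show ?case .
    qed
    from this[of 0] have "l1_norm (x t) \<le> c * g t" for t
      using x[of t] M by (metis mult.right_neutral one_mult_mat_vec pow_mat.simps(1) carrier_matD(1) power_0)
    then have "\<bar>l1_norm (x t)\<bar> \<le> \<bar>c * g t\<bar>" for t using l1_norm_nonneg(1)[of "x t"] by (metis abs_ge_self l1_norm_nonneg(2) order_trans)
    moreover have "norm_bounded q {..T} (\<lambda>t. c * g t) (c * (b / (1 - \<gamma>)))"
      using geometric_filter_bound[OF \<gamma> _ g b] c by (intro norm_bounded_scale) auto
    ultimately show ?thesis
      by (auto intro: norm_bounded_mono)
  qed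
  show ?thesis
  proof (intro exI[of _ "c / (1 - \<gamma>)"] conjI allI impI)
    show "0 \<le> c / (1 - \<gamma>)" using c \<gamma> by simp
  qed (rule bound, blast+)
qed

section \<open>Conversion between signal norms and real bounds\<close>

lemma ennsqrt_le_iff:
  assumes "0 \<le> b"
  shows "ennsqrt s \<le> ennreal b \<longleftrightarrow> s \<le> ennreal (b\<^sup>2)"
proof (cases s)
  case (real r)
  then show ?thesis using assms real_sqrt_le_iff[of r "b\<^sup>2"] by (simp add: ennsqrt_def ennreal_le_iff)
qed (simp add: ennsqrt_def top_unique)

lemma signal_norm_leI:
  assumes "0 \<le> b" "norm_bounded q T (\<lambda>t. l1_norm (u t)) b"
  shows "signal_norm q T u \<le> ennreal b"
proof (cases q)
  case Infty
  show ?thesis unfolding Infty signal_norm.simps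
  proof (intro SUP_least)
    fix t i assume ti: "t \<in> T" "i \<in> {..<dim_vec (u t)}"
    have "\<bar>u t $ i\<bar> \<le> l1_norm (u t)" using ti by (simp add: abs_index_le_l1_norm)
    also have "\<dots> \<le> b" using assms ti Infty by simp
    finally show "ennreal \<bar>u t $ i\<bar> \<le> ennreal b" by (rule ennreal_leI)
  qed
next
  case Two
  have "(\<Sum>t\<in>F. \<Sum>i<dim_vec (u t). ennreal (\<bar>u t $ i\<bar>\<^sup>2)) \<le> ennreal (b\<^sup>2)"
    if F: "finite F" "F \<subseteq> T" for F
  proof -
    have sq: "(\<Sum>i<dim_vec (u t). \<bar>u t $ i\<bar>\<^sup>2) \<le> (l1_norm (u t))\<^sup>2" for t
      using L2_set_le_sum_abs[of "\<lambda>i. u t $ i" "{..<dim_vec (u t)}"] sqrt_le_D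
      by (fastforce simp: l1_norm_def L2_set_def)
    have "L2_set (\<lambda>t. l1_norm (u t)) F \<le> b" using assms F Two by simp
    then have "(\<Sum>t\<in>F. (l1_norm (u t))\<^sup>2) \<le> b\<^sup>2"
      unfolding L2_set_def by (rule sqrt_le_D)
    then have "(\<Sum>t\<in>F. \<Sum>i<dim_vec (u t). \<bar>u t $ i\<bar>\<^sup>2) \<le> b\<^sup>2"
      using sum_mono[of F, OF sq] by (rule order_trans[rotated])
    then show ?thesis by (simp add: sum_nonneg ennreal_leI)
  qed
  then show ?thesis unfolding Two signal_norm.simps ennsqrt_le_iff[OF assms(1)]
    by (subst nonneg_infsum_complete) (auto intro!: SUP_least)
qed

text \<open>
  Each coordinate is bounded by the signal norm, and the 1-norm is the sum of the \<open>d\<close> coordinates;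
  the loss of a factor \<open>d\<close> is harmless because only finiteness of constants matters.
\<close>

lemma signal_norm_leD:
  assumes "0 \<le> b" "signal_norm q T u \<le> ennreal b" "\<And>t. t \<in> T \<Longrightarrow> u t \<in> carrier_vec d"
  shows "norm_bounded q T (\<lambda>t. l1_norm (u t)) (real d * b)"
proof -
  have "norm_bounded q T (\<lambda>t. \<bar>u t $ i\<bar>) b" if i: "i < d" for i
  proof (cases q)
    case Infty
    have "\<bar>u t $ i\<bar> \<le> b" if t: "t \<in> T" for t
    proof -
      have "ennreal \<bar>u t $ i\<bar> \<le> (SUP i\<in>{..<dim_vec (u t)}. ennreal \<bar>u t $ i\<bar>)"
        using assms(3)[OF t] i by - (rule SUP_upper2[where i=i], auto)
      also have "\<dots> \<le> signal_norm Infty T u"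
        unfolding signal_norm.simps using t by - (rule SUP_upper2[where i=t], auto)
      also have "\<dots> \<le> ennreal b" using assms(2) Infty by simp
      finally show ?thesis using assms(1) by (simp add: ennreal_le_iff)
    qed
    then show ?thesis using Infty by simp
  next
    case Two
    have "L2_set (\<lambda>t. \<bar>u t $ i\<bar>) F \<le> b" if F: "finite F" "F \<subseteq> T" for F
    proof -
      have "ennreal (\<Sum>t\<in>F. \<bar>u t $ i\<bar>\<^sup>2) = (\<Sum>t\<in>F. ennreal (\<bar>u t $ i\<bar>\<^sup>2))"
        by (simp add: sum_ennreal)
      also have "\<dots> \<le> (\<Sum>t\<in>F. \<Sum>i<dim_vec (u t). ennreal (\<bar>u t $ i\<bar>\<^sup>2))"
      proof (rule sum_mono)
        fix t assume "t \<in> F"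
        then have "i \<in> {..<dim_vec (u t)}" using F assms(3)[of t] i by auto
        then show "ennreal (\<bar>u t $ i\<bar>\<^sup>2) \<le> (\<Sum>i<dim_vec (u t). ennreal (\<bar>u t $ i\<bar>\<^sup>2))"
          by (intro member_le_sum[where f="\<lambda>i. ennreal (\<bar>u t $ i\<bar>\<^sup>2)"]) auto
      qed
      also have "\<dots> \<le> (\<Sum>\<^sub>\<infinity>t\<in>T. \<Sum>i<dim_vec (u t). ennreal (\<bar>u t $ i\<bar>\<^sup>2))"
        using F by - (subst nonneg_infsum_complete, simp, rule SUP_upper2[where i=F], auto)
      also have "\<dots> \<le> ennreal (b\<^sup>2)"
        using assms(2) unfolding Two signal_norm.simps ennsqrt_le_iff[OF assms(1)] .
      finally have "(\<Sum>t\<in>F. \<bar>u t $ i\<bar>\<^sup>2) \<le> b\<^sup>2" by (subst (asm) ennreal_le_iff) auto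
      then show ?thesis
        unfolding L2_set_def using assms(1) by (intro real_le_lsqrt) (auto intro: sum_nonneg)
    qed
    then show ?thesis using Two by simp
  qed
  then have "norm_bounded q T (\<lambda>t. \<Sum>i<d. \<bar>u t $ i\<bar>) (\<Sum>i<d. b)"
    by (intro norm_bounded_sum) auto
  then show ?thesis
    by (rule norm_bounded_mono) (use carrier_vecD[OF assms(3)] in \<open>auto simp: l1_norm_def sum_nonneg\<close>)
qed

section \<open>Selecting rows\<close>

lemma vec_rows_carrier [simp]:
  assumes "v \<in> carrier_vec m" "I \<subseteq> {..<m}"
  shows "vec_rows v I \<in> carrier_vec (card I)"
proof -
  have "{i. i < m \<and> i \<in> I} = I" using assms by auto
  then show ?thesis using assms by (simp add: vec_rows_def)
qed

lemma dim_vec_rows: "v \<in> carrier_vec m \<Longrightarrow> I \<subseteq> {..<m} \<Longrightarrow> dim_vec (vec_rows v I) = card I"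
  using vec_rows_carrier[of v m I] by simp

lemma vec_rows_index:
  assumes "v \<in> carrier_vec m" "I \<subseteq> {..<m}" "i < card I"
  shows "vec_rows v I $ i = v $ pick I i"
proof -
  have "{i. i < m \<and> i \<in> I} = I" using assms by auto
  then show ?thesis using assms by (simp add: vec_rows_def)
qed

lemma pick_less:
  assumes "I \<subseteq> {..<m}" "i < card I"
  shows "pick I i < m"
  using pick_in_set_le[OF assms(2)] assms(1) by auto

lemma mat_rows_carrier [simp]:
  assumes "M \<in> carrier_mat m n" "I \<subseteq> {..<m}"
  shows "mat_rows M I \<in> carrier_mat (card I) n"
proof -
  have "{i. i < m \<and> i \<in> I} = I" using assms by auto
  then show ?thesis using assms by (intro carrier_matI) (simp_all add: mat_rows_def dim_submatrix)
qed

lemma mat_rows_mult_vec: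
  assumes "M \<in> carrier_mat m n" "I \<subseteq> {..<m}" "x \<in> carrier_vec n"
  shows "mat_rows M I *\<^sub>v x = vec_rows (M *\<^sub>v x) I"
proof (rule eq_vecI)
  have I: "{i. i < m \<and> i \<in> I} = I" using assms by auto
  have Mx: "M *\<^sub>v x \<in> carrier_vec m" using assms by simp
  show "dim_vec (mat_rows M I *\<^sub>v x) = dim_vec (vec_rows (M *\<^sub>v x) I)"
    using mat_rows_carrier[OF assms(1,2)] vec_rows_carrier[OF Mx assms(2)] by simp
  fix i assume "i < dim_vec (vec_rows (M *\<^sub>v x) I)"
  then have i: "i < card I" using vec_rows_carrier[OF Mx assms(2)] by simp
  have "row (mat_rows M I) i = row M (pick I i)"
  proof (rule eq_vecI)
    show "dim_vec (row (mat_rows M I) i) = dim_vec (row M (pick I i))"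
      using mat_rows_carrier[OF assms(1,2)] assms(1) by simp
    fix j assume "j < dim_vec (row M (pick I i))"
    then have j: "j < n" using assms(1) by simp
    have "mat_rows M I $$ (i, j) = M $$ (pick I i, j)"
      unfolding mat_rows_def using assms(1) I i j by (subst submatrix_index) (simp_all add: pick_UNIV)
    then show "row (mat_rows M I) i $ j = row M (pick I i) $ j"
      using mat_rows_carrier[OF assms(1,2)] assms(1) i j pick_less[OF assms(2) i] by simp
  qed
  then show "(mat_rows M I *\<^sub>v x) $ i = vec_rows (M *\<^sub>v x) I $ i"
    using mat_rows_carrier[OF assms(1,2)] vec_rows_index[OF Mx assms(2) i] i pick_less[OF assms(2) i] assms(1) by simp
qed

lemma vec_rows_add:
  assumes "u \<in> carrier_vec m" "v \<in> carrier_vec m" "I \<subseteq> {..<m}"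
  shows "vec_rows (u + v) I = vec_rows u I + vec_rows v I"
  using assms pick_less[OF assms(3)]
  by (intro eq_vecI) (auto simp: vec_rows_index[of _ m] dim_vec_rows[of _ m])

lemma vec_rows_diff:
  assumes "u \<in> carrier_vec m" "v \<in> carrier_vec m" "I \<subseteq> {..<m}"
  shows "vec_rows (u - v) I = vec_rows u I - vec_rows v I"
  using assms pick_less[OF assms(3)]
  by (intro eq_vecI) (auto simp: vec_rows_index[of _ m] dim_vec_rows[of _ m])

lemma l1_norm_vec_rows:
  assumes "v \<in> carrier_vec m" "I \<subseteq> {..<m}"
  shows "l1_norm (vec_rows v I) = (\<Sum>i\<in>I. \<bar>v $ i\<bar>)"
proof -
  have fin: "finite I" using assms(2) finite_subset by blast
  have inj: "inj_on (pick I) {..<card I}"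
    by (rule inj_onI) (metis lessThan_iff nat_neq_iff pick_mono_le)
  have "pick I ` {..<card I} = I"
    using card_image[OF inj] fin pick_in_set_le by (intro card_subset_eq) auto
  then have "bij_betw (pick I) {..<card I} I" using inj by (simp add: bij_betw_def)
  then have "(\<Sum>i<card I. \<bar>v $ pick I i\<bar>) = (\<Sum>i\<in>I. \<bar>v $ i\<bar>)"
    by (rule sum.reindex_bij_betw)
  then show ?thesis
    using carrier_vecD[OF vec_rows_carrier[OF assms]] vec_rows_index[OF assms] by (simp add: l1_norm_def)
qed

text \<open>
  Rows are renumbered upon selection, so for \<open>J \<subseteq> I\<close> the vector \<open>vec_rows v J\<close> is not obtained from
  \<open>vec_rows v I\<close> with the same index set. Only its size is needed, and that is a sum over the selected
  set.
\<close>

lemma l1_norm_vec_rows_mono: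
  assumes "v \<in> carrier_vec m" "I \<subseteq> {..<m}" "J \<subseteq> I"
  shows "l1_norm (vec_rows v J) \<le> l1_norm (vec_rows v I)"
  using assms finite_subset[OF assms(2)]
  by (simp add: l1_norm_vec_rows[of v m] subset_trans[of J I] sum_mono2)

section \<open>Finite induced norms\<close>

lemma norm_bounded_mult_mat_vec:
  assumes "0 \<le> c" "\<forall>x\<in>carrier_vec d. l1_norm (M *\<^sub>v x) \<le> c * l1_norm x"
    and "\<And>t. u t \<in> carrier_vec d" "norm_bounded q T (\<lambda>t. l1_norm (u t)) b"
  shows "norm_bounded q T (\<lambda>t. l1_norm (M *\<^sub>v u t)) (c * b)"
proof (rule norm_bounded_mono[OF norm_bounded_scale[OF assms(4,1)]])
  show "\<bar>l1_norm (M *\<^sub>v u t)\<bar> \<le> \<bar>c * l1_norm (u t)\<bar>" for t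
    using assms(1-3) by (simp add: abs_mult)
qed auto

lemma norm_bounded_l1_add:
  assumes "norm_bounded q T (\<lambda>t. l1_norm (u t)) b" "norm_bounded q T (\<lambda>t. l1_norm (v t)) b'"
    and "\<And>t. u t \<in> carrier_vec d" "\<And>t. v t \<in> carrier_vec d"
  shows "norm_bounded q T (\<lambda>t. l1_norm (u t + v t)) (b + b')"
proof (rule norm_bounded_mono[OF norm_bounded_add[OF assms(1,2)]])
  show "\<bar>l1_norm (u t + v t)\<bar> \<le> \<bar>l1_norm (u t) + l1_norm (v t)\<bar>" for t
    using l1_norm_add[OF assms(3,4)[of t]] by (simp add: abs_of_nonneg)
qed auto

lemma lti_state_carrier:
  assumes "A \<in> carrier_mat n n" "B \<in> carrier_mat n l" "w \<in> signals l"
  shows "lti_state (A, B, C, D) w t \<in> carrier_vec n"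
  using assms by (induction t) (auto simp: signals_def)

lemma stable_system_gain:
  assumes A: "A \<in> carrier_mat n n" and B: "B \<in> carrier_mat n l"
    and C: "C \<in> carrier_mat m n" and D: "D \<in> carrier_mat m l" and st: "strictly_stable A"
  shows "\<exists>c\<ge>0. \<forall>q w b. w \<in> signals l \<longrightarrow> 0 \<le> b \<longrightarrow> norm_bounded q UNIV (\<lambda>t. l1_norm (w t)) b \<longrightarrow>
    norm_bounded q UNIV (\<lambda>t. l1_norm (lti_state (A, B, C, D) w t)) (c * b) \<and>
    norm_bounded q UNIV (\<lambda>t. l1_norm (lti_output (A, B, C, D) w t)) (c * b)"
proof -
  obtain cA where cA: "0 \<le> cA" and stable: "\<And>q x u T b. x 0 = 0\<^sub>v n \<Longrightarrow> (\<And>t. u t \<in> carrier_vec n) \<Longrightarrow>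
      (\<And>t. x (Suc t) = A *\<^sub>v x t + u t) \<Longrightarrow> 0 \<le> b \<Longrightarrow> norm_bounded q {..T} (\<lambda>t. l1_norm (u t)) b \<Longrightarrow>
      norm_bounded q {..T} (\<lambda>t. l1_norm (x t)) (cA * b)"
    using stable_recursion_bound[OF A st] by blast
  obtain cB where cB: "0 \<le> cB" "\<forall>x\<in>carrier_vec l. l1_norm (B *\<^sub>v x) \<le> cB * l1_norm x"
    using mult_mat_vec_l1_bounded[OF B] by blast
  obtain cC where cC: "0 \<le> cC" "\<forall>x\<in>carrier_vec n. l1_norm (C *\<^sub>v x) \<le> cC * l1_norm x"
    using mult_mat_vec_l1_bounded[OF C] by blast
  obtain cD where cD: "0 \<le> cD" "\<forall>x\<in>carrier_vec l. l1_norm (D *\<^sub>v x) \<le> cD * l1_norm x"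
    using mult_mat_vec_l1_bounded[OF D] by blast
  define c where "c = cA * cB + (cC * (cA * cB) + cD)"
  have c: "0 \<le> c" "cA * cB \<le> c" "cC * (cA * cB) + cD \<le> c"
    using cA cB cC cD by (auto simp: c_def)
  have gain: "norm_bounded q UNIV (\<lambda>t. l1_norm (lti_state (A, B, C, D) w t)) (c * b) \<and>
    norm_bounded q UNIV (\<lambda>t. l1_norm (lti_output (A, B, C, D) w t)) (c * b)"
    if w: "w \<in> signals l" and b: "0 \<le> b" and nw: "norm_bounded q UNIV (\<lambda>t. l1_norm (w t)) b" for q w b
  proof -
    let ?x = "lti_state (A, B, C, D) w"
    have w': "\<And>t. w t \<in> carrier_vec l" using w by (simp add: signals_def)
    have x: "\<And>t. ?x t \<in> carrier_vec n" using lti_state_carrier[OF A B w] .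
    have Bw: "norm_bounded q UNIV (\<lambda>t. l1_norm (B *\<^sub>v w t)) (cB * b)"
      using norm_bounded_mult_mat_vec[OF cB w' nw] .
    have "norm_bounded q {..T} (\<lambda>t. l1_norm (?x t)) (cA * (cB * b))" for T
    proof (rule stable)
      show "norm_bounded q {..T} (\<lambda>t. l1_norm (B *\<^sub>v w t)) (cB * b)"
        using Bw by (rule norm_bounded_mono) auto
    qed (use A B cB b w' in auto)
    then have nx: "norm_bounded q UNIV (\<lambda>t. l1_norm (?x t)) (cA * (cB * b))"
      by (rule norm_bounded_from_truncations) (use cA cB b in auto)
    have ny: "norm_bounded q UNIV (\<lambda>t. l1_norm (lti_output (A, B, C, D) w t)) (cC * (cA * (cB * b)) + cD * b)"
      unfolding lti_output.simps
      by (rule norm_bounded_l1_add[where d=m])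
        (use norm_bounded_mult_mat_vec[OF cC x nx] norm_bounded_mult_mat_vec[OF cD w' nw] C D x w' in auto)
    have "cA * (cB * b) \<le> c * b" "cC * (cA * (cB * b)) + cD * b \<le> c * b"
      using mult_right_mono[OF c(2) b] mult_right_mono[OF c(3) b] by (simp_all add: algebra_simps)
    then show ?thesis using nx ny by (auto elim: norm_bounded_mono)
  qed
  then show ?thesis using c(1) by blast
qed

lemma input_norm_bounded:
  assumes "w \<in> signals l" "0 \<le> b" "signal_norm p UNIV w \<le> ennreal b"
    and "(p, q) \<in> {(Two, Two), (Two, Infty), (Infty, Infty)}"
  shows "norm_bounded q UNIV (\<lambda>t. l1_norm (w t)) (real l * b)"
proof -
  have "norm_bounded p UNIV (\<lambda>t. l1_norm (w t)) (real l * b)"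
    using assms by (intro signal_norm_leD) (auto simp: signals_def)
  then show ?thesis using assms(4) norm_bounded_Two_imp_Infty by blast
qed

lemma induced_norm_finite:
  assumes A: "A \<in> carrier_mat n n" and B: "B \<in> carrier_mat n l"
    and C: "C \<in> carrier_mat m n" and D: "D \<in> carrier_mat m l" and st: "strictly_stable A"
    and pq: "(p, q) \<in> {(Two, Two), (Two, Infty), (Infty, Infty)}"
  shows "induced_norm p q (A, B, C, D) < \<infinity>"
proof -
  let ?G = "(A, B, C, D)"
  obtain c where c: "0 \<le> c" and gain: "\<And>w b. w \<in> signals l \<Longrightarrow> 0 \<le> b \<Longrightarrow>
      norm_bounded q UNIV (\<lambda>t. l1_norm (w t)) b \<Longrightarrow> norm_bounded q UNIV (\<lambda>t. l1_norm (lti_output ?G w t)) (c * b)"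
    using stable_system_gain[OF A B C D st] by blast
  have "induced_norm p q ?G \<le> ennreal (c * real l)"
    unfolding induced_norm_def
  proof (rule SUP_least, safe)
    fix w assume w: "w \<in> signals (input_dim ?G)" and pos: "0 < signal_norm p UNIV w"
      and fin: "signal_norm p UNIV w < \<infinity>"
    obtain b where b: "0 \<le> b" "signal_norm p UNIV w = ennreal b"
      using fin by (cases "signal_norm p UNIV w") auto
    then have b_pos: "0 < b" using pos by simp
    have w': "w \<in> signals l" using w B by simp
    have "norm_bounded q UNIV (\<lambda>t. l1_norm (lti_output ?G w t)) (c * (real l * b))"
      using input_norm_bounded[OF w' b(1) _ pq] b(1,2) by (intro gain[OF w']) auto
    then have "signal_norm q UNIV (lti_output ?G w) \<le> ennreal (c * (real l * b))"
      using c b by (intro signal_norm_leI) auto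
    then have "signal_norm q UNIV (lti_output ?G w) / signal_norm p UNIV w \<le> ennreal (c * (real l * b)) / ennreal b"
      unfolding b(2) by (rule divide_right_mono_ennreal)
    also have "\<dots> = ennreal (c * real l)" using b_pos c by (subst divide_ennreal) auto
    finally show "signal_norm q UNIV (lti_output ?G w) / signal_norm p UNIV w \<le> ennreal (c * real l)" .
  qed
  also have "\<dots> < \<infinity>" by simp
  finally show ?thesis .
qed

text \<open>
  The supremum defining the induced norm ranges over inputs of nonzero norm only; for an input of norm
  \<open>0\<close> the finite gain of the system shows that the output vanishes.
\<close>

lemma output_norm_le_induced_norm:
  assumes A: "A \<in> carrier_mat n n" and B: "B \<in> carrier_mat n l"
    and C: "C \<in> carrier_mat m n" and D: "D \<in> carrier_mat m l" and st: "strictly_stable A"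
    and pq: "(p, q) \<in> {(Two, Two), (Two, Infty), (Infty, Infty)}"
    and w: "w \<in> signals l" "signal_norm p UNIV w \<le> 1"
  shows "signal_norm q UNIV (lti_output (A, B, C, D) w) \<le> induced_norm p q (A, B, C, D)"
proof (cases "signal_norm p UNIV w = 0")
  case True
  let ?G = "(A, B, C, D)"
  obtain c where gain: "\<And>w b. w \<in> signals l \<Longrightarrow> 0 \<le> b \<Longrightarrow>
      norm_bounded q UNIV (\<lambda>t. l1_norm (w t)) b \<Longrightarrow> norm_bounded q UNIV (\<lambda>t. l1_norm (lti_output ?G w t)) (c * b)"
    using stable_system_gain[OF A B C D st] by blast
  have "norm_bounded q UNIV (\<lambda>t. l1_norm (w t)) 0"
    using input_norm_bounded[OF w(1), of 0 p q] True pq by simp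
  from gain[OF w(1) _ this] have "signal_norm q UNIV (lti_output ?G w) \<le> ennreal 0"
    by (intro signal_norm_leI) auto
  then show ?thesis by simp
next
  case False
  let ?N = "signal_norm p UNIV w" and ?y = "signal_norm q UNIV (lti_output (A, B, C, D) w)"
  have fin: "?N < \<infinity>" using w(2) by (auto intro: order.strict_trans1)
  have "?y / ?N \<le> induced_norm p q (A, B, C, D)"
    unfolding induced_norm_def using w(1) B False fin by (intro SUP_upper) (auto simp: zero_less_iff_neq_zero)
  then have "?y / ?N * ?N \<le> induced_norm p q (A, B, C, D) * 1"
    using w(2) by (intro mult_mono) auto
  then show ?thesis using False fin by (simp add: ennreal_divide_times)
qed

lemma signal_norm_truncate_le: "signal_norm q T u \<le> signal_norm q UNIV u"
proof (cases q)
  case Infty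
  then show ?thesis by (auto intro: SUP_subset_mono)
next
  case Two
  have "(\<Sum>\<^sub>\<infinity>t\<in>T. f t) \<le> (\<Sum>\<^sub>\<infinity>t. f t)" for f :: "nat \<Rightarrow> ennreal"
    by (simp add: nonneg_infsum_complete) (intro SUP_subset_mono, auto)
  moreover have "ennsqrt s \<le> ennsqrt s'" if "s \<le> s'" for s s'
    using that by (auto simp: ennsqrt_def top_unique less_top intro!: ennreal_leI enn2real_mono)
  ultimately show ?thesis using Two by simp
qed

lemma add_diff_vec_swap:
  fixes a b c :: "real vec"
  assumes "a \<in> carrier_vec n" "b \<in> carrier_vec n" "c \<in> carrier_vec n"
  shows "(a + b) - c = (a - c) + b"
  using assms by (intro eq_vecI) auto

lemma diff_diff_vec_cancel:
  fixes a b c :: "real vec"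
  assumes "a \<in> carrier_vec n" "b \<in> carrier_vec n" "c \<in> carrier_vec n"
  shows "(a - b) - (a - c) = c - b"
  using assms by (intro eq_vecI) auto

lemma diff_diff_add_vec:
  fixes a b c d e :: "real vec"
  assumes "a \<in> carrier_vec n" "b \<in> carrier_vec n" "c \<in> carrier_vec n" "d \<in> carrier_vec n" "e \<in> carrier_vec n"
  shows "(a + b) - (c - (d + e)) = ((a - c) + d) + (b + e)"
  using assms by (intro eq_vecI) auto

lemma diff_diff_split_vec:
  fixes a b c d e :: "real vec"
  assumes "a \<in> carrier_vec n" "b \<in> carrier_vec n" "c \<in> carrier_vec n" "d \<in> carrier_vec n" "e \<in> carrier_vec n"
  shows "(a - b) - (c - d) = ((a - c) + e) + ((d - b) - e)"
  using assms by (intro eq_vecI) auto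

lemma local_estimate_carrier:
  assumes "A \<in> carrier_mat n n" "C \<in> carrier_mat m n" "I \<subseteq> {..<m}" "L \<in> carrier_mat n (card I)"
    and "y \<in> signals m"
  shows "local_estimate (A, B, C, D) I L y t \<in> carrier_vec n"
    and "local_residual (A, B, C, D) I L y t \<in> carrier_vec (card I)"
proof -
  show est: "local_estimate (A, B, C, D) I L y t \<in> carrier_vec n"
    using assms(1) by (induction t) (use assms in \<open>auto simp: signals_def intro!: minus_carrier_vec mult_mat_vec_carrier vec_rows_carrier mat_rows_carrier\<close>)
  show "local_residual (A, B, C, D) I L y t \<in> carrier_vec (card I)"
    using assms est by (auto simp: signals_def intro!: minus_carrier_vec mult_mat_vec_carrier vec_rows_carrier mat_rows_carrier)
qed

lemma lti_output_carrier:
  assumes "A \<in> carrier_mat n n" "B \<in> carrier_mat n l" "C \<in> carrier_mat m n" "D \<in> carrier_mat m l" "w \<in> signals l"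
  shows "lti_output (A, B, C, D) w t \<in> carrier_vec m"
  using lti_state_carrier[OF assms(1,2,5)] assms by (auto simp: signals_def)

section \<open>Local estimators\<close>

text \<open>
  If the sensors in \<open>I\<close> are not attacked, the residual equals \<open>C\<^sub>I e + D\<^sub>I w\<close> with \<open>e\<close> the estimation error.
  Substituting this into the observer recursion shows that \<open>e\<close> and the residual are exactly the state
  and the output of \<open>residual_system\<close> driven by the disturbance, so the attack drops out completely.
\<close>

lemma attack_free_local_estimate:
  assumes A: "A \<in> carrier_mat n n" and B: "B \<in> carrier_mat n l"
    and C: "C \<in> carrier_mat m n" and D: "D \<in> carrier_mat m l"
    and I: "I \<subseteq> {..<m}" and L: "L \<in> carrier_mat n (card I)"
    and w: "w \<in> signals l" and y: "y \<in> signals m"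
    and clean: "\<And>t. vec_rows (y t) I = vec_rows (lti_output (A, B, C, D) w t) I"
  defines "F \<equiv> residual_system (A, B, C, D) I L"
  shows "lti_state (A, B, C, D) w t - local_estimate (A, B, C, D) I L y t = lti_state F w t"
    and "local_residual (A, B, C, D) I L y t = lti_output F w t"
proof -
  let ?x = "lti_state (A, B, C, D) w" and ?xh = "local_estimate (A, B, C, D) I L y"
  let ?CI = "mat_rows C I" and ?DI = "mat_rows D I"
  note CI = mat_rows_carrier[OF C I] and DI = mat_rows_carrier[OF D I]
  have w': "\<And>t. w t \<in> carrier_vec l" using w by (simp add: signals_def)
  have x: "\<And>t. ?x t \<in> carrier_vec n" using lti_state_carrier[OF A B w] .
  have xh: "\<And>t. ?xh t \<in> carrier_vec n" using local_estimate_carrier(1)[OF A C I L y] .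
  have res: "local_residual (A, B, C, D) I L y t = ?CI *\<^sub>v (?x t - ?xh t) + ?DI *\<^sub>v w t" for t
  proof -
    have "vec_rows (y t) I = ?CI *\<^sub>v ?x t + ?DI *\<^sub>v w t"
      using clean[of t] C D x[of t] w'[of t]
      by (simp add: vec_rows_add[OF _ _ I] mat_rows_mult_vec[OF C I x] mat_rows_mult_vec[OF D I w'])
    moreover have "?CI *\<^sub>v (?x t - ?xh t) = ?CI *\<^sub>v ?x t - ?CI *\<^sub>v ?xh t"
      using mult_minus_distrib_mat_vec[OF CI x xh] .
    moreover note add_diff_vec_swap[OF mult_mat_vec_carrier[OF CI x] mult_mat_vec_carrier[OF DI w'] mult_mat_vec_carrier[OF CI xh]]
    ultimately show ?thesis by (simp only: local_residual.simps)
  qed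
  have err: "?x t - ?xh t = lti_state F w t" for t
  proof (induction t)
    case 0
    then show ?case using A L by (simp add: F_def)
  next
    case (Suc t)
    let ?e = "?x t - ?xh t"
    have e: "?e \<in> carrier_vec n" using x xh by simp
    have "?x (Suc t) - ?xh (Suc t) = (A *\<^sub>v ?x t + B *\<^sub>v w t) - (A *\<^sub>v ?xh t - L *\<^sub>v (?CI *\<^sub>v ?e + ?DI *\<^sub>v w t))"
      using res[of t] by simp
    also have "L *\<^sub>v (?CI *\<^sub>v ?e + ?DI *\<^sub>v w t) = L *\<^sub>v (?CI *\<^sub>v ?e) + L *\<^sub>v (?DI *\<^sub>v w t)"
      using mult_add_distrib_mat_vec[OF L mult_mat_vec_carrier[OF CI e] mult_mat_vec_carrier[OF DI w']] .
    also have "(A *\<^sub>v ?x t + B *\<^sub>v w t) - (A *\<^sub>v ?xh t - (L *\<^sub>v (?CI *\<^sub>v ?e) + L *\<^sub>v (?DI *\<^sub>v w t)))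
        = ((A *\<^sub>v ?x t - A *\<^sub>v ?xh t) + L *\<^sub>v (?CI *\<^sub>v ?e)) + (B *\<^sub>v w t + L *\<^sub>v (?DI *\<^sub>v w t))"
      by (rule diff_diff_add_vec[where n=n]; intro mult_mat_vec_carrier[OF A] mult_mat_vec_carrier[OF B] mult_mat_vec_carrier[OF L]
          mult_mat_vec_carrier[OF CI] mult_mat_vec_carrier[OF DI] x xh w' e)
    also have "A *\<^sub>v ?x t - A *\<^sub>v ?xh t = A *\<^sub>v ?e"
      using mult_minus_distrib_mat_vec[OF A x xh] by simp
    also have "A *\<^sub>v ?e + L *\<^sub>v (?CI *\<^sub>v ?e) = (A + L * ?CI) *\<^sub>v ?e"
      using add_mult_distrib_mat_vec[OF A mult_carrier_mat[OF L CI] e] assoc_mult_mat_vec[OF L CI e] by simp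
    also have "B *\<^sub>v w t + L *\<^sub>v (?DI *\<^sub>v w t) = (B + L * ?DI) *\<^sub>v w t"
      using add_mult_distrib_mat_vec[OF B mult_carrier_mat[OF L DI] w'] assoc_mult_mat_vec[OF L DI w'] by simp
    also have "(A + L * ?CI) *\<^sub>v ?e + (B + L * ?DI) *\<^sub>v w t = lti_state F w (Suc t)"
      by (simp only: Suc F_def residual_system.simps lti_state.simps)
    finally show ?case .
  qed
  show "?x t - ?xh t = lti_state F w t" by (rule err)
  show "local_residual (A, B, C, D) I L y t = lti_output F w t"
    using res[of t] err[of t] by (simp add: F_def)
qed

text \<open>
  Let \<open>d\<close> be the difference of two local estimates. It evolves by \<open>A\<close> plus injected residuals, and seen
  through a common sensor set \<open>S\<close> it is a difference of residuals, because the measurement \<open>y\<^sub>S\<close> cancels: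
  \<open>C\<^sub>S d = (y\<^sub>S - C\<^sub>S x\<^sub>J) - (y\<^sub>S - C\<^sub>S x\<^sub>I)\<close>. Adding and subtracting \<open>N C\<^sub>S d\<close> with a stabilizing gain \<open>N\<close>
  makes \<open>d\<close> the state of a strictly stable recursion driven by residuals alone. The
  measurement enters only through the residuals, so the bound holds under any attack.
\<close>

lemma local_estimates_agree:
  assumes A: "A \<in> carrier_mat n n" and C: "C \<in> carrier_mat m n"
    and I: "I \<subseteq> {..<m}" and J: "J \<subseteq> {..<m}" and S: "S \<subseteq> I \<inter> J"
    and L: "L \<in> carrier_mat n (card I)" and M: "M \<in> carrier_mat n (card J)"
    and det: "detectable A (mat_rows C S)"
  shows "\<exists>c\<ge>0. \<forall>q y T b b'. y \<in> signals m \<longrightarrow> 0 \<le> b \<longrightarrow> 0 \<le> b' \<longrightarrow>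
    norm_bounded q {..T} (\<lambda>t. l1_norm (local_residual (A, B, C, D) I L y t)) b \<longrightarrow>
    norm_bounded q {..T} (\<lambda>t. l1_norm (local_residual (A, B, C, D) J M y t)) b' \<longrightarrow>
    norm_bounded q {..T}
      (\<lambda>t. l1_norm (local_estimate (A, B, C, D) I L y t - local_estimate (A, B, C, D) J M y t)) (c * (b + b'))"
proof -
  have Sm: "S \<subseteq> {..<m}" "S \<subseteq> I" "S \<subseteq> J" using S I by auto
  note CS = mat_rows_carrier[OF C Sm(1)]
  obtain N where N: "N \<in> carrier_mat n (card S)" and st: "strictly_stable (A + N * mat_rows C S)"
    using det A CS unfolding detectable_def by auto
  have NC: "N * mat_rows C S \<in> carrier_mat n n" using N CS by simp
  obtain cS where cS: "0 \<le> cS" and stable: "\<And>q x u T b. x 0 = 0\<^sub>v n \<Longrightarrow> (\<And>t. u t \<in> carrier_vec n) \<Longrightarrow>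
      (\<And>t. x (Suc t) = (A + N * mat_rows C S) *\<^sub>v x t + u t) \<Longrightarrow> 0 \<le> b \<Longrightarrow>
      norm_bounded q {..T} (\<lambda>t. l1_norm (u t)) b \<Longrightarrow> norm_bounded q {..T} (\<lambda>t. l1_norm (x t)) (cS * b)"
    using stable_recursion_bound[OF add_carrier_mat[OF NC, of A] st] by blast
  obtain cL where cL: "0 \<le> cL" "\<forall>x\<in>carrier_vec (card I). l1_norm (L *\<^sub>v x) \<le> cL * l1_norm x"
    using mult_mat_vec_l1_bounded[OF L] by blast
  obtain cM where cM: "0 \<le> cM" "\<forall>x\<in>carrier_vec (card J). l1_norm (M *\<^sub>v x) \<le> cM * l1_norm x"
    using mult_mat_vec_l1_bounded[OF M] by blast
  obtain cN where cN: "0 \<le> cN" "\<forall>x\<in>carrier_vec (card S). l1_norm (N *\<^sub>v x) \<le> cN * l1_norm x"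
    using mult_mat_vec_l1_bounded[OF N] by blast
  define k where "k = cL + cM + cN"
  have k: "0 \<le> k" using cL cM cN by (simp add: k_def)
  have bound: "norm_bounded q {..T}
      (\<lambda>t. l1_norm (local_estimate (A, B, C, D) I L y t - local_estimate (A, B, C, D) J M y t)) (cS * k * (b + b'))"
    if y: "y \<in> signals m" and b: "0 \<le> b" "0 \<le> b'"
      and nI: "norm_bounded q {..T} (\<lambda>t. l1_norm (local_residual (A, B, C, D) I L y t)) b"
      and nJ: "norm_bounded q {..T} (\<lambda>t. l1_norm (local_residual (A, B, C, D) J M y t)) b'" for q y T b b'
  proof -
    define xI where "xI = local_estimate (A, B, C, D) I L y"
    define xJ where "xJ = local_estimate (A, B, C, D) J M y"
    define rI where "rI = local_residual (A, B, C, D) I L y"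
    define rJ where "rJ = local_residual (A, B, C, D) J M y"
    have xI: "\<And>t. xI t \<in> carrier_vec n" and rI: "\<And>t. rI t \<in> carrier_vec (card I)"
      unfolding xI_def rI_def using local_estimate_carrier[OF A C I L y] by auto
    have xJ: "\<And>t. xJ t \<in> carrier_vec n" and rJ: "\<And>t. rJ t \<in> carrier_vec (card J)"
      unfolding xJ_def rJ_def using local_estimate_carrier[OF A C J M y] by auto
    have y': "\<And>t. y t \<in> carrier_vec m" using y by (simp add: signals_def)
    define d where "d = (\<lambda>t. xI t - xJ t)"
    have d: "\<And>t. d t \<in> carrier_vec n" using xI xJ by (simp add: d_def)
    \<comment> \<open>The difference of the two residuals on \<open>S\<close>; it equals \<open>C\<^sub>S d\<close> (fact \<open>v_eq\<close>).\<close>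
    define v where "v = (\<lambda>t. vec_rows (y t - C *\<^sub>v xJ t) S - vec_rows (y t - C *\<^sub>v xI t) S)"
    define u where "u = (\<lambda>t. (M *\<^sub>v rJ t - L *\<^sub>v rI t) - N *\<^sub>v v t)"
    have rI_rows: "rI t = vec_rows (y t - C *\<^sub>v xI t) I" for t
      unfolding rI_def xI_def[symmetric] using y'[of t] C xI[of t]
      by (simp add: xI_def[symmetric] vec_rows_diff[OF _ _ I] mat_rows_mult_vec[OF C I xI])
    have rJ_rows: "rJ t = vec_rows (y t - C *\<^sub>v xJ t) J" for t
      unfolding rJ_def using y'[of t] C xJ[of t]
      by (simp add: xJ_def[symmetric] vec_rows_diff[OF _ _ J] mat_rows_mult_vec[OF C J xJ])
    have fI: "y t - C *\<^sub>v xI t \<in> carrier_vec m" and fJ: "y t - C *\<^sub>v xJ t \<in> carrier_vec m" for t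
      using y' C xI xJ by auto
    have v: "v t \<in> carrier_vec (card S)" for t
      using vec_rows_carrier[OF fI Sm(1)] vec_rows_carrier[OF fJ Sm(1)] by (simp add: v_def)
    have v_eq: "mat_rows C S *\<^sub>v d t = v t" for t
    proof -
      have Cx: "C *\<^sub>v xI t \<in> carrier_vec m" "C *\<^sub>v xJ t \<in> carrier_vec m" using C xI xJ by auto
      have "v t = vec_rows ((y t - C *\<^sub>v xJ t) - (y t - C *\<^sub>v xI t)) S"
        unfolding v_def by (rule vec_rows_diff[OF fJ fI Sm(1), symmetric])
      also have "(y t - C *\<^sub>v xJ t) - (y t - C *\<^sub>v xI t) = C *\<^sub>v xI t - C *\<^sub>v xJ t"
        using diff_diff_vec_cancel[OF y' Cx(2) Cx(1)] .
      also have "\<dots> = C *\<^sub>v d t"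
        unfolding d_def by (rule mult_minus_distrib_mat_vec[OF C xI xJ, symmetric])
      finally show ?thesis using mat_rows_mult_vec[OF C Sm(1) d] by simp
    qed
    have Lr: "L *\<^sub>v rI t \<in> carrier_vec n" and Mr: "M *\<^sub>v rJ t \<in> carrier_vec n"
      and Nv: "N *\<^sub>v v t \<in> carrier_vec n" for t
      using mult_mat_vec_carrier[OF L rI] mult_mat_vec_carrier[OF M rJ] mult_mat_vec_carrier[OF N v] by auto
    have u: "u t \<in> carrier_vec n" for t using Lr Mr Nv by (simp add: u_def)
    have step: "d (Suc t) = (A + N * mat_rows C S) *\<^sub>v d t + u t" for t
    proof -
      have Ax: "A *\<^sub>v xI t \<in> carrier_vec n" "A *\<^sub>v xJ t \<in> carrier_vec n" using A xI xJ by auto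
      have "d (Suc t) = (A *\<^sub>v xI t - L *\<^sub>v rI t) - (A *\<^sub>v xJ t - M *\<^sub>v rJ t)"
        by (simp add: d_def xI_def xJ_def rI_def rJ_def)
      also have "\<dots> = ((A *\<^sub>v xI t - A *\<^sub>v xJ t) + N *\<^sub>v v t) + u t"
        unfolding u_def by (rule diff_diff_split_vec[OF Ax(1) Lr Ax(2) Mr Nv])
      also have "A *\<^sub>v xI t - A *\<^sub>v xJ t = A *\<^sub>v d t"
        unfolding d_def by (rule mult_minus_distrib_mat_vec[OF A xI xJ, symmetric])
      also have "A *\<^sub>v d t + N *\<^sub>v v t = (A + N * mat_rows C S) *\<^sub>v d t"
        using add_mult_distrib_mat_vec[OF A NC d] assoc_mult_mat_vec[OF N CS d] v_eq[of t] by simp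
      finally show ?thesis .
    qed
    have u_le: "l1_norm (u t) \<le> k * (l1_norm (rI t) + l1_norm (rJ t))" for t
    proof -
      have "l1_norm (v t) \<le> l1_norm (vec_rows (y t - C *\<^sub>v xJ t) S) + l1_norm (vec_rows (y t - C *\<^sub>v xI t) S)"
        unfolding v_def by (rule l1_norm_diff[OF vec_rows_carrier[OF fJ Sm(1)] vec_rows_carrier[OF fI Sm(1)]])
      also have "\<dots> \<le> l1_norm (rJ t) + l1_norm (rI t)"
        unfolding rI_rows rJ_rows
        by (intro add_mono l1_norm_vec_rows_mono[OF fJ J Sm(3)] l1_norm_vec_rows_mono[OF fI I Sm(2)])
      finally have "cN * l1_norm (v t) \<le> cN * (l1_norm (rI t) + l1_norm (rJ t))"
        using cN by (intro mult_left_mono) auto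
      moreover have "l1_norm (u t) \<le> l1_norm (M *\<^sub>v rJ t) + l1_norm (L *\<^sub>v rI t) + l1_norm (N *\<^sub>v v t)"
        using l1_norm_diff[OF minus_carrier_vec[OF Mr Lr] Nv, of t t t] l1_norm_diff[OF Mr Lr, of t t]
        unfolding u_def by linarith
      moreover have "l1_norm (M *\<^sub>v rJ t) \<le> cM * l1_norm (rJ t)" "l1_norm (L *\<^sub>v rI t) \<le> cL * l1_norm (rI t)"
        "l1_norm (N *\<^sub>v v t) \<le> cN * l1_norm (v t)"
        using cM(2) cL(2) cN(2) rJ rI v by auto
      moreover have "0 \<le> cM * l1_norm (rI t)" "0 \<le> cL * l1_norm (rJ t)" using cM(1) cL(1) by auto
      ultimately show ?thesis by (simp add: k_def algebra_simps)
    qed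
    have "norm_bounded q {..T} (\<lambda>t. k * (l1_norm (rI t) + l1_norm (rJ t))) (k * (b + b'))"
      using nI nJ k unfolding rI_def rJ_def by (intro norm_bounded_scale norm_bounded_add)
    then have "norm_bounded q {..T} (\<lambda>t. l1_norm (u t)) (k * (b + b'))"
    proof (rule norm_bounded_mono)
      show "\<bar>l1_norm (u t)\<bar> \<le> \<bar>k * (l1_norm (rI t) + l1_norm (rJ t))\<bar>" for t
        using u_le[of t] by (metis abs_ge_self l1_norm_nonneg(2) order_trans)
    qed auto
    then have "norm_bounded q {..T} (\<lambda>t. l1_norm (d t)) (cS * (k * (b + b')))"
      using k b by (intro stable[of d u] u step) (use A in \<open>auto simp: d_def xI_def xJ_def\<close>)
    then show ?thesis by (simp add: d_def xI_def xJ_def mult.assoc)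
  qed
  show ?thesis
    using bound cS k by (intro exI[of _ "cS * k"]) simp
qed

section \<open>The global estimator\<close>

text \<open>
  The midrange and the mean both lie in the convex hull of the values, so either is within the largest
  deviation of any reference \<open>x\<close>. The sum of all deviations is a cruder bound, but it lets the norm
  over time be estimated separately for each \<open>I\<close>.
\<close>

lemma abs_diff_midrange_le:
  fixes f :: "'i \<Rightarrow> real"
  assumes V: "finite V" "V \<noteq> {}"
  shows "\<bar>x - (Min (f ` V) + Max (f ` V)) / 2\<bar> \<le> (\<Sum>I\<in>V. \<bar>f I - x\<bar>)"
proof -
  have le: "\<bar>f I - x\<bar> \<le> (\<Sum>I\<in>V. \<bar>f I - x\<bar>)" if "I \<in> V" for I
    using that V by (intro member_le_sum) auto
  have "Min (f ` V) \<in> f ` V" "Max (f ` V) \<in> f ` V" using V by auto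
  then obtain I J where "I \<in> V" "Min (f ` V) = f I" "J \<in> V" "Max (f ` V) = f J" by auto
  then show ?thesis using le[of I] le[of J] by (simp add: abs_if field_simps split: if_splits)
qed

lemma abs_diff_mean_le:
  fixes f :: "'i \<Rightarrow> real"
  assumes V: "finite V" "V \<noteq> {}"
  shows "\<bar>x - (\<Sum>I\<in>V. f I) / real (card V)\<bar> \<le> (\<Sum>I\<in>V. \<bar>f I - x\<bar>)"
proof -
  have card: "1 \<le> real (card V)" using V by (simp add: Suc_le_eq card_gt_0_iff)
  then have "(\<Sum>I\<in>V. f I) / real (card V) - x = (\<Sum>I\<in>V. f I - x) / real (card V)"
    by (simp add: sum_subtractf diff_divide_distrib)
  then have "\<bar>x - (\<Sum>I\<in>V. f I) / real (card V)\<bar> = \<bar>\<Sum>I\<in>V. f I - x\<bar> / real (card V)"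
    using card by (metis abs_divide abs_minus_commute abs_of_nat)
  also have "\<dots> \<le> \<bar>\<Sum>I\<in>V. f I - x\<bar> / 1"
    using card by (intro divide_left_mono) auto
  also have "\<dots> \<le> (\<Sum>I\<in>V. \<bar>f I - x\<bar>)" by simp
  finally show ?thesis .
qed

text \<open>
  The standing assumptions: a bank of stable local observers, one for each set of \<open>m - \<rho>\<close> sensors, for
  a system that remains detectable after the loss of any \<open>2\<rho>\<close> sensors.
\<close>

locale redundant_observer_bank =
  fixes A B C D :: "real mat" and K :: "nat set \<Rightarrow> real mat"
    and n l m \<rho> :: nat and p q :: exponent
  assumes A: "A \<in> carrier_mat n n" and B: "B \<in> carrier_mat n l"
    and C: "C \<in> carrier_mat m n" and D: "D \<in> carrier_mat m l"
    and pq: "(p, q) \<in> {(Two, Two), (Two, Infty), (Infty, Infty)}"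
    and redundancy: "chi_detectable (2 * \<rho>) (A, B, C, D)"
    and gain: "I \<in> sensor_sets m \<rho> \<Longrightarrow> K I \<in> carrier_mat n (m - \<rho>)"
    and stable: "I \<in> sensor_sets m \<rho> \<Longrightarrow> strictly_stable (A + K I * mat_rows C I)"
begin

abbreviation G :: lti where "G \<equiv> (A, B, C, D)"
abbreviation "est I y \<equiv> local_estimate G I (K I) y"
abbreviation "res I y \<equiv> local_residual G I (K I) y"
abbreviation "V y t \<equiv> valid_sets p q G \<rho> K y t"

lemma sensor_setsD:
  assumes "I \<in> sensor_sets m \<rho>"
  shows "I \<subseteq> {..<m}" "card I = m - \<rho>" "K I \<in> carrier_mat n (card I)"
  using assms gain by (auto simp: sensor_sets_def)

lemma finite_sensor_sets: "finite (sensor_sets m \<rho>)"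
  unfolding sensor_sets_def by (rule finite_subset[of _ "Pow {..<m}"]) auto

lemma residual_system_carrier:
  assumes I: "I \<in> sensor_sets m \<rho>"
  shows "A + K I * mat_rows C I \<in> carrier_mat n n" "B + K I * mat_rows D I \<in> carrier_mat n l"
    "mat_rows C I \<in> carrier_mat (card I) n" "mat_rows D I \<in> carrier_mat (card I) l"
  using sensor_setsD[OF I] mat_rows_carrier[OF C, of I] mat_rows_carrier[OF D, of I] A B by auto

text \<open>
  Passing the validity test bounds the residual by the induced norm, which is finite, no matter whether
  the sensors in \<open>I\<close> are attacked.
\<close>

lemma valid_residual_bound:
  assumes I: "I \<in> sensor_sets m \<rho>"
  shows "\<exists>b\<ge>0. \<forall>y t. y \<in> signals m \<longrightarrow> I \<in> V y t \<longrightarrow> norm_bounded q {..t} (\<lambda>s. l1_norm (res I y s)) b"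
proof -
  have "induced_norm p q (residual_system G I (K I)) < \<infinity>"
    using induced_norm_finite[OF residual_system_carrier[OF I] stable[OF I] pq] by simp
  then obtain c where c: "0 \<le> c" "induced_norm p q (residual_system G I (K I)) = ennreal c"
    by (cases "induced_norm p q (residual_system G I (K I))") auto
  have "norm_bounded q {..t} (\<lambda>s. l1_norm (res I y s)) (real (card I) * c)"
    if "y \<in> signals m" "I \<in> V y t" for y t
  proof (rule signal_norm_leD[OF c(1)])
    show "signal_norm q {..t} (res I y) \<le> ennreal c"
      using that(2) c(2) by (simp add: valid_sets_def)
    show "res I y s \<in> carrier_vec (card I)" for s
      using local_estimate_carrier(2)[OF A C sensor_setsD(1,3)[OF I] that(1)] .
  qed
  then show ?thesis using c(1) by (intro exI[of _ "real (card I) * c"]) auto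
qed

text \<open>
  This is where \<open>2\<rho>\<close>-detectability enters: two sets of \<open>m - \<rho>\<close> sensors share at least \<open>m - 2\<rho>\<close>
  sensors, and the system is detectable from these.
\<close>

lemma valid_estimates_agree:
  assumes I: "I \<in> sensor_sets m \<rho>" and J: "J \<in> sensor_sets m \<rho>"
  shows "\<exists>c\<ge>0. \<forall>y t. y \<in> signals m \<longrightarrow> I \<in> V y t \<longrightarrow> J \<in> V y t \<longrightarrow>
    norm_bounded q {..t} (\<lambda>s. l1_norm (est I y s - est J y s)) c"
proof -
  have m: "2 * \<rho> \<le> m"
    and det: "\<And>S. S \<subseteq> {..<m} \<Longrightarrow> card S = m - 2 * \<rho> \<Longrightarrow> detectable A (mat_rows C S)"
    using redundancy C by auto
  have fin: "finite I" "finite J" "card (I \<union> J) \<le> m"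
    using sensor_setsD(1)[OF I] sensor_setsD(1)[OF J] finite_subset card_mono[of "{..<m}" "I \<union> J"] by auto
  then have "m - 2 * \<rho> \<le> card (I \<inter> J)"
    using card_Un_Int[of I J] sensor_setsD(2)[OF I] sensor_setsD(2)[OF J] m by linarith
  then obtain S where S: "S \<subseteq> I \<inter> J" "card S = m - 2 * \<rho>"
    by (rule obtain_subset_with_card_n)
  then have detS: "detectable A (mat_rows C S)" using det sensor_setsD(1)[OF I] by blast
  obtain c where c: "0 \<le> c" and agree: "\<And>y t b b'. y \<in> signals m \<Longrightarrow> 0 \<le> b \<Longrightarrow> 0 \<le> b' \<Longrightarrow>
      norm_bounded q {..t} (\<lambda>s. l1_norm (res I y s)) b \<Longrightarrow> norm_bounded q {..t} (\<lambda>s. l1_norm (res J y s)) b' \<Longrightarrow>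
      norm_bounded q {..t} (\<lambda>s. l1_norm (est I y s - est J y s)) (c * (b + b'))"
    using local_estimates_agree[OF A C sensor_setsD(1)[OF I] sensor_setsD(1)[OF J] S(1)
        sensor_setsD(3)[OF I] sensor_setsD(3)[OF J] detS, of B D] by blast
  obtain b where b: "0 \<le> b" "\<And>y t. y \<in> signals m \<Longrightarrow> I \<in> V y t \<Longrightarrow>
      norm_bounded q {..t} (\<lambda>s. l1_norm (res I y s)) b"
    using valid_residual_bound[OF I] by blast
  obtain b' where b': "0 \<le> b'" "\<And>y t. y \<in> signals m \<Longrightarrow> J \<in> V y t \<Longrightarrow>
      norm_bounded q {..t} (\<lambda>s. l1_norm (res J y s)) b'"
    using valid_residual_bound[OF J] by blast
  show ?thesis
    using agree b b' c by (intro exI[of _ "c * (b + b')"]) simp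
qed

lemma global_estimate_near_valid:
  assumes "y \<in> signals m" and J: "J \<in> V y t"
  shows "l1_norm (est J y t - global_estimate p q G \<rho> K y t) \<le> (\<Sum>I\<in>V y t. l1_norm (est I y t - est J y t))"
proof -
  have sub: "V y t \<subseteq> sensor_sets m \<rho>" using C by (auto simp: valid_sets_def)
  then have fin: "finite (V y t)" "V y t \<noteq> {}" using finite_sensor_sets finite_subset J by auto
  have est: "est I y t \<in> carrier_vec n" if "I \<in> V y t" for I
    using that sub assms(1) by (intro local_estimate_carrier(1)[OF A C]) (auto dest: sensor_setsD)
  have coord: "\<bar>(est J y t - global_estimate p q G \<rho> K y t) $ i\<bar> \<le> (\<Sum>I\<in>V y t. \<bar>(est I y t - est J y t) $ i\<bar>)"
    if i: "i < n" for i
  proof -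
    have "(\<Sum>I\<in>V y t. \<bar>(est I y t - est J y t) $ i\<bar>) = (\<Sum>I\<in>V y t. \<bar>est I y t $ i - est J y t $ i\<bar>)"
      using carrier_vecD[OF est[OF J]] i by (intro sum.cong) auto
    then show ?thesis
      using abs_diff_midrange_le[OF fin, of "est J y t $ i" "\<lambda>I. est I y t $ i"]
        abs_diff_mean_le[OF fin, of "est J y t $ i" "\<lambda>I. est I y t $ i"] est[OF J] i A
      by (cases q) (auto simp: global_estimate_def Let_def)
  qed
  have "dim_vec (est J y t - global_estimate p q G \<rho> K y t) = n" using A by (simp add: global_estimate_def)
  then have "l1_norm (est J y t - global_estimate p q G \<rho> K y t) \<le> (\<Sum>i<n. \<Sum>I\<in>V y t. \<bar>(est I y t - est J y t) $ i\<bar>)"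
    unfolding l1_norm_def using coord by (simp only:) (intro sum_mono, simp)
  also have "\<dots> = (\<Sum>I\<in>V y t. \<Sum>i<n. \<bar>(est I y t - est J y t) $ i\<bar>)" by (rule sum.swap)
  also have "\<dots> = (\<Sum>I\<in>V y t. l1_norm (est I y t - est J y t))"
    using carrier_vecD[OF est[OF J]] by (intro sum.cong) (auto simp: l1_norm_def)
  finally show ?thesis .
qed

text \<open>
  At each time only the currently valid estimators contribute to the error. The contribution of \<open>I\<close>,
  cut off to its valid times, has a finite norm over all times by \<open>norm_bounded_from_truncations\<close>; there
  are finitely many \<open>I\<close>, and the constants do not depend on the measurement.
\<close>

lemma global_estimate_near_always_valid:
  assumes J: "J \<in> sensor_sets m \<rho>"
  shows "\<exists>c\<ge>0. \<forall>y. y \<in> signals m \<longrightarrow> (\<forall>t. J \<in> V y t) \<longrightarrow>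
    norm_bounded q UNIV (\<lambda>t. l1_norm (est J y t - global_estimate p q G \<rho> K y t)) c"
proof -
  have "\<forall>I\<in>sensor_sets m \<rho>. \<exists>c. 0 \<le> c \<and> (\<forall>y t. y \<in> signals m \<longrightarrow> I \<in> V y t \<longrightarrow> J \<in> V y t \<longrightarrow>
      norm_bounded q {..t} (\<lambda>s. l1_norm (est I y s - est J y s)) c)"
    using valid_estimates_agree[OF _ J] by simp
  from bchoice[OF this] obtain c where c: "\<And>I. I \<in> sensor_sets m \<rho> \<Longrightarrow> 0 \<le> c I"
    and agree: "\<And>I y t. I \<in> sensor_sets m \<rho> \<Longrightarrow> y \<in> signals m \<Longrightarrow> I \<in> V y t \<Longrightarrow> J \<in> V y t \<Longrightarrow>
      norm_bounded q {..t} (\<lambda>s. l1_norm (est I y s - est J y s)) (c I)"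
    by blast
  have "norm_bounded q UNIV (\<lambda>t. l1_norm (est J y t - global_estimate p q G \<rho> K y t)) (\<Sum>I\<in>sensor_sets m \<rho>. c I)"
    if y: "y \<in> signals m" and valid: "\<And>t. J \<in> V y t" for y
  proof -
    define v where "v = (\<lambda>I t. if t \<in> {t. I \<in> V y t} then l1_norm (est I y t - est J y t) else 0)"
    have "norm_bounded q UNIV (v I) (c I)" if I: "I \<in> sensor_sets m \<rho>" for I
      unfolding v_def
    proof (rule norm_bounded_extend_by_zero[OF norm_bounded_from_truncations])
      show "norm_bounded q {..t} (\<lambda>t. l1_norm (est I y t - est J y t)) (c I)" if "t \<in> {t. I \<in> V y t}" for t
        using agree[OF I y _ valid] that by simp
    qed (use c[OF I] in auto)
    then have "norm_bounded q UNIV (\<lambda>t. \<Sum>I\<in>sensor_sets m \<rho>. v I t) (\<Sum>I\<in>sensor_sets m \<rho>. c I)"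
      by (intro norm_bounded_sum finite_sensor_sets)
    then show ?thesis
    proof (rule norm_bounded_mono)
      fix t
      have sub: "V y t \<subseteq> sensor_sets m \<rho>" using C by (auto simp: valid_sets_def)
      have "(\<Sum>I\<in>V y t. l1_norm (est I y t - est J y t)) = (\<Sum>I\<in>V y t. v I t)"
        by (intro sum.cong) (auto simp: v_def)
      also have "\<dots> \<le> (\<Sum>I\<in>sensor_sets m \<rho>. v I t)"
        using sub by (intro sum_mono2 finite_sensor_sets) (auto simp: v_def)
      finally show "\<bar>l1_norm (est J y t - global_estimate p q G \<rho> K y t)\<bar> \<le> \<bar>\<Sum>I\<in>sensor_sets m \<rho>. v I t\<bar>"
        using global_estimate_near_valid[OF y valid, of t] by simp
    qed auto
  qed
  then show ?thesis using c by (intro exI[of _ "\<Sum>I\<in>sensor_sets m \<rho>. c I"]) (auto intro: sum_nonneg)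
qed

lemma vec_rows_attack_free:
  assumes a: "a \<in> signals m" and I: "I \<subseteq> {..<m}" and zero: "\<And>t i. i \<in> I \<Longrightarrow> a t $ i = 0"
    and w: "w \<in> signals l"
  shows "vec_rows (lti_output G w t + a t) I = vec_rows (lti_output G w t) I"
proof (rule eq_vecI)
  have out: "lti_output G w t \<in> carrier_vec m" "a t \<in> carrier_vec m"
    using lti_output_carrier[OF A B C D w] a by (auto simp: signals_def)
  show "dim_vec (vec_rows (lti_output G w t + a t) I) = dim_vec (vec_rows (lti_output G w t) I)"
    using out I by (simp add: dim_vec_rows[of _ m] del: lti_output.simps)
  fix i assume "i < dim_vec (vec_rows (lti_output G w t) I)"
  then have i: "i < card I" using out I by (simp add: dim_vec_rows[of _ m] del: lti_output.simps)
  show "vec_rows (lti_output G w t + a t) I $ i = vec_rows (lti_output G w t) I $ i"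
    using out I i zero[OF pick_in_set_le[OF i]] pick_less[OF I i]
    by (simp add: vec_rows_index[of _ m] del: lti_output.simps)
qed

text \<open>
  The estimator \<open>J\<close> of unattacked sensors is valid at all times, since its residual is an output of
  \<open>residual_system\<close> for a disturbance of norm at most \<open>1\<close>. Hence the true state is close to its estimate,
  which in turn is close to the global estimate.
\<close>

lemma attack_free_error_bound:
  assumes J: "J \<in> sensor_sets m \<rho>"
  shows "\<exists>c\<ge>0. \<forall>w a. w \<in> signals l \<longrightarrow> a \<in> signals m \<longrightarrow> signal_norm p UNIV w \<le> 1 \<longrightarrow>
    (\<forall>t. \<forall>i\<in>J. a t $ i = 0) \<longrightarrow>
    signal_norm q UNIV (\<lambda>t. lti_state G w t - global_estimate p q G \<rho> K (\<lambda>s. lti_output G w s + a s) t) \<le> ennreal c"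
proof -
  note J' = sensor_setsD[OF J]
  let ?F = "residual_system G J (K J)"
  obtain cF where cF: "0 \<le> cF" and gainF: "\<And>w b. w \<in> signals l \<Longrightarrow> 0 \<le> b \<Longrightarrow>
      norm_bounded q UNIV (\<lambda>t. l1_norm (w t)) b \<Longrightarrow> norm_bounded q UNIV (\<lambda>t. l1_norm (lti_state ?F w t)) (cF * b)"
    using stable_system_gain[OF residual_system_carrier[OF J] stable[OF J]] by auto
  obtain cG where cG: "0 \<le> cG" and near: "\<And>y. y \<in> signals m \<Longrightarrow> (\<And>t. J \<in> V y t) \<Longrightarrow>
      norm_bounded q UNIV (\<lambda>t. l1_norm (est J y t - global_estimate p q G \<rho> K y t)) cG"
    using global_estimate_near_always_valid[OF J] by blast
  have "signal_norm q UNIV (\<lambda>t. lti_state G w t - global_estimate p q G \<rho> K (\<lambda>s. lti_output G w s + a s) t)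
      \<le> ennreal (cF * real l + cG)"
    if w: "w \<in> signals l" and a: "a \<in> signals m" and w1: "signal_norm p UNIV w \<le> 1"
      and free: "\<And>t i. i \<in> J \<Longrightarrow> a t $ i = 0" for w a
  proof -
    define y where "y = (\<lambda>s. lti_output G w s + a s)"
    have y: "y \<in> signals m"
      using lti_output_carrier[OF A B C D w] a unfolding y_def signals_def by (auto simp del: lti_output.simps)
    have clean: "vec_rows (y t) J = vec_rows (lti_output G w t) J" for t
      unfolding y_def by (rule vec_rows_attack_free[OF a J'(1) free w])
    note local = attack_free_local_estimate[OF A B C D J'(1,3) w y clean]
    have "signal_norm q {..t} (res J y) \<le> induced_norm p q ?F" for t
    proof -
      have "res J y = lti_output ?F w" using local(2) by blast
      then have "signal_norm q {..t} (res J y) \<le> signal_norm q UNIV (lti_output ?F w)"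
        using signal_norm_truncate_le by metis
      also have "\<dots> \<le> induced_norm p q ?F"
        using output_norm_le_induced_norm[OF residual_system_carrier[OF J] stable[OF J] pq w w1] by simp
      finally show ?thesis .
    qed
    then have valid: "J \<in> V y t" for t using J C by (simp add: valid_sets_def)
    have "norm_bounded q UNIV (\<lambda>t. l1_norm (w t)) (real l * 1)"
      using w1 by (intro input_norm_bounded[OF w _ _ pq]) auto
    from gainF[OF w _ this]
    have e1: "norm_bounded q UNIV (\<lambda>t. l1_norm (lti_state G w t - est J y t)) (cF * real l)"
      by (simp add: local(1))
    have x: "lti_state G w t \<in> carrier_vec n" and xJ: "est J y t \<in> carrier_vec n"
      and xh: "global_estimate p q G \<rho> K y t \<in> carrier_vec n" for t
      using lti_state_carrier[OF A B w] local_estimate_carrier(1)[OF A C J'(1,3) y] A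
      by (auto simp: global_estimate_def)
    have "norm_bounded q UNIV
        (\<lambda>t. l1_norm ((lti_state G w t - est J y t) + (est J y t - global_estimate p q G \<rho> K y t))) (cF * real l + cG)"
      using norm_bounded_l1_add[OF e1 near[OF y valid], of n] x xJ xh by simp
    moreover have "(lti_state G w t - est J y t) + (est J y t - global_estimate p q G \<rho> K y t)
        = lti_state G w t - global_estimate p q G \<rho> K y t" for t
      using x[of t] xJ[of t] xh[of t] by (intro eq_vecI) auto
    ultimately show ?thesis
      unfolding y_def[symmetric] using cF cG by (intro signal_norm_leI) auto
  qed
  then show ?thesis using cF cG by (intro exI[of _ "cF * real l + cG"]) auto
qed

lemma attack_free_sensor_set:
  assumes a: "a \<in> signals m" and sparse: "l0_norm a \<le> \<rho>"
  obtains J where "J \<in> sensor_sets m \<rho>" "\<And>t i. i \<in> J \<Longrightarrow> a t $ i = 0"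
proof -
  define Z where "Z = {i. \<exists>t. i < dim_vec (a t) \<and> a t $ i \<noteq> 0}"
  have dim: "\<And>t. dim_vec (a t) = m" using a by (simp add: signals_def)
  have Z: "Z \<subseteq> {..<m}" "card Z \<le> \<rho>" using dim sparse by (auto simp: Z_def l0_norm_def)
  then have "m - \<rho> \<le> card ({..<m} - Z)"
    by (subst card_Diff_subset) (auto intro: finite_subset)
  then obtain J where J: "J \<subseteq> {..<m} - Z" "card J = m - \<rho>"
    by (rule obtain_subset_with_card_n)
  then have "J \<in> sensor_sets m \<rho>" by (auto simp: sensor_sets_def)
  moreover have "a t $ i = 0" if "i \<in> J" for t i
    using that J dim by (auto simp: Z_def)
  ultimately show thesis using that by blast
qed

text \<open>
  Which sensor set is unattacked depends on the attack; summing the constants over all candidate sets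
  makes the bound uniform.
\<close>

theorem global_estimate_resilient: "\<exists>\<epsilon>>0. resilient p q G \<rho> (global_estimate p q G \<rho> K) \<epsilon>"
proof -
  let ?error = "\<lambda>w a t. lti_state G w t - global_estimate p q G \<rho> K (\<lambda>s. lti_output G w s + a s) t"
  have "\<forall>J\<in>sensor_sets m \<rho>. \<exists>c. 0 \<le> c \<and> (\<forall>w a. w \<in> signals l \<longrightarrow> a \<in> signals m \<longrightarrow>
      signal_norm p UNIV w \<le> 1 \<longrightarrow> (\<forall>t. \<forall>i\<in>J. a t $ i = 0) \<longrightarrow> signal_norm q UNIV (?error w a) \<le> ennreal c)"
    using attack_free_error_bound by simp
  from bchoice[OF this] obtain c where c: "\<And>J. J \<in> sensor_sets m \<rho> \<Longrightarrow> 0 \<le> c J"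
    and bound: "\<And>J w a. J \<in> sensor_sets m \<rho> \<Longrightarrow> w \<in> signals l \<Longrightarrow> a \<in> signals m \<Longrightarrow>
      signal_norm p UNIV w \<le> 1 \<Longrightarrow> (\<forall>t. \<forall>i\<in>J. a t $ i = 0) \<Longrightarrow>
      signal_norm q UNIV (?error w a) \<le> ennreal (c J)"
    by blast
  define M where "M = (\<Sum>J\<in>sensor_sets m \<rho>. c J)"
  have M: "0 \<le> M" unfolding M_def by (intro sum_nonneg c)
  have "signal_norm q UNIV (?error w a) \<le> ennreal M"
    if w: "w \<in> signals l" and a: "a \<in> signals m" and w1: "signal_norm p UNIV w \<le> 1" and a0: "l0_norm a \<le> \<rho>" for w a
  proof -
    obtain J where J: "J \<in> sensor_sets m \<rho>" "\<And>t i. i \<in> J \<Longrightarrow> a t $ i = 0"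
      using attack_free_sensor_set[OF a a0] by blast
    have "c J \<le> M" unfolding M_def using J(1) finite_sensor_sets c by (intro member_le_sum) auto
    then show ?thesis using bound[OF J(1) w a w1] J(2) by (meson ennreal_leI order_trans)
  qed
  then have "(SUP (w, a)\<in>{(w, a). w \<in> signals (input_dim G) \<and> a \<in> signals (output_dim G)
      \<and> signal_norm p UNIV w \<le> 1 \<and> l0_norm a \<le> \<rho>}. signal_norm q UNIV (?error w a)) \<le> ennreal M"
    using B C by (intro SUP_least) (simp add: case_prod_unfold del: lti_output.simps)
  also have "\<dots> < ennreal (M + 1)" using M by (intro ennreal_lessI) auto
  finally have "resilient p q G \<rho> (global_estimate p q G \<rho> K) (M + 1)"
    unfolding resilient_def .
  then show ?thesis using M by (intro exI[of _ "M + 1"]) auto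
qed

end

theorem corollary2:
  fixes A B C D :: "real mat" and K :: "nat set \<Rightarrow> real mat"
    and n l m \<rho> :: nat and p q :: exponent
  assumes "A \<in> carrier_mat n n" and "B \<in> carrier_mat n l"
    and "C \<in> carrier_mat m n" and "D \<in> carrier_mat m l"
    and full_row_rank: "vec_space.rank n B = n"
    and "(p, q) \<in> {(Two, Two), (Two, Infty), (Infty, Infty)}"
    and "chi_detectable (2 * \<rho>) (A, B, C, D)"
    and gains: "\<And>I. I \<in> sensor_sets m \<rho> \<Longrightarrow>
      K I \<in> carrier_mat n (m - \<rho>) \<and> strictly_stable (A + K I * mat_rows C I)"
  shows "\<exists>\<epsilon>>0. resilient p q (A, B, C, D) \<rho> (global_estimate p q (A, B, C, D) \<rho> K) \<epsilon>"
proof -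
  interpret redundant_observer_bank A B C D K n l m \<rho> p q
    by unfold_locales (use assms in blast)+
  show ?thesis by (rule global_estimate_resilient)
qed

end
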